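(* Fix $\lambda\ge1$. For small $\varepsilon>0$ let $(w_{1,\varepsilon},w_{2,\varepsilon},\varphi_{1,\varepsilon},\varphi_{2,\varepsilon})$ be the heteroclinic orbit described in the context, let $\Lambda=1+\varepsilon^2$, and set \[ u(z)=\left(1-\varepsilon^2w_{1,\varepsilon}(\varepsilon z)\right)\cos\varphi_{1,\varepsilon}(\varepsilon z),\qquad v(z)=\left(1-\varepsilon^2w_{1,\varepsilon}(\varepsilon z)\right)\sin\varphi_{1,\varepsilon}(\varepsilon z),\qquad z\in\mathbb{R}. \] Then, for all sufficiently small $\varepsilon>0$, the pair $(u,v)$, which solves \[ \lambda^2\ddot u=u^3-u+\Lambda v^2u,\qquad \ddot v=v^3-v+\Lambda u^2v, \] with $(u,v)\to(0,1)$ as $z\to-\infty$ and $(u,v)\to(1,0)$ as $z\to+\infty$, coincides with the unique (up to translations) minimizing heteroclinic connection of this problem, i.e. with the (unique up to translations) minimizer of \[ E_\Lambda(u,v)=\int_{-\infty}^{\infty}\left[\lambda^2\frac{(\dot u)^2}{2}+\frac{(\dot v)^2}{2}+\frac{(1-u^2-v^2)^2}{4}+\frac{\Lambda-1}{2}u^2v^2\right]dz \] over \[ \mathcal{X}=\left\{(u,v)\in W^{1,2}_{loc}(\mathbb{R})\times W^{1,2}_{loc}(\mathbb{R}):\ (u,v)\to(0,1)\ \text{as}\ z\to-\infty,\ (u,v)\to(1,0)\ \text{as}\ z\to+\infty\right\}. \]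
   Context: Throughout $\lambda\ge1$ is a fixed constant, $\dot{}=d/dz$ and $'=d/dx$, where $x=\varepsilon z$. **The system (S$_\varepsilon$).** For $\varepsilon>0$, \[ \begin{aligned} \varepsilon w_1'&=w_2,\\ \varepsilon w_2'&=-(1-\varepsilon^2w_1)\varphi_2^2-(1-\varepsilon^2w_1)(\varepsilon^2w_1^2-2w_1)\left[1+\left(\tfrac{1}{\lambda^2}-1\right)\cos^2\varphi_1\right]\\ &\quad-(1-\varepsilon^2w_1)^3\left(\tfrac{1}{\lambda^2}+1\right)\sin^2\varphi_1\cos^2\varphi_1,\\ \varphi_1'&=\varphi_2,\\ \varphi_2'&=\frac{2\varepsilon w_2\varphi_2}{1-\varepsilon^2w_1}+\left(1-\tfrac{1}{\lambda^2}\right)(\varepsilon^2w_1^2-2w_1)\sin\varphi_1\cos\varphi_1\\ &\quad+(1-\varepsilon^2w_1)^2\left(\sin\varphi_1\cos^3\varphi_1-\tfrac{1}{\lambda^2}\cos\varphi_1\sin^3\varphi_1\right). \end{aligned} \] **The limit functions.** $\varphi_{1,0}$ is the unique solution of \[ \varphi_1'=-\frac{1}{2\lambda}\sin(2\varphi_1)\left[1+\left(\tfrac{1}{\lambda^2}-1\right)\cos^2\varphi_1\right]^{-1/2},\quad \varphi_1\to\tfrac{\pi}{2}\ (x\to-\infty),\quad \varphi_1\to0\ (x\to+\infty), \] with $\varphi_{1,0}(0)=\frac{\pi}{4}$, and $\varphi_{2,0}=\varphi_{1,0}'$. **The manifolds $\mathcal{M}_\varepsilon$.** Let $\mathcal{K}$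 be a compact subset of the $(\varphi_1,\varphi_2)$ plane which is the closure of a smooth domain containing the curve $\{(\varphi_{1,0}(x),\varphi_{2,0}(x)):x\in\mathbb{R}\}$ together with its endpoints $(\frac{\pi}{2},0)$ and $(0,0)$, and which is symmetric with respect to the lines $\varphi_1=0$ and $\varphi_2=0$. Let $m\ge1$ be a given integer. By Fenichel's theorem there are $h_1,h_2\in C^m(\mathcal{K}\times[0,\infty))$ and $\varepsilon_0>0$ such that for every $\varepsilon\in(0,\varepsilon_0)$ the graph \[ \mathcal{M}_\varepsilon:\quad w_1=\frac{\varphi_2^2+\left(\frac{1}{\lambda^2}+1\right)\sin^2\varphi_1\cos^2\varphi_1}{2\left[1+\left(\frac{1}{\lambda^2}-1\right)\cos^2\varphi_1\right]}+\varepsilon h_1(\varphi_1,\varphi_2,\varepsilon),\quad w_2=\varepsilon h_2(\varphi_1,\varphi_2,\varepsilon),\quad(\varphi_1,\varphi_2)\in\mathcal{K}, \] is locally invariant under (S$_\varepsilon$) (solutions starting on it can leave it only through its boundary), with $h_i(\frac{\pi}{2},0,\varepsilon)=h_i(0,0,\varepsilon)=0$ and $h_i(-\varphi_1,-\varphi_2,\varepsilon)=h_i(\varphi_1,\varphi_2,\varepsilon)$, $i=1,2$, $\varepsilon\in[0,\varepsilon_0)$. Such a family is fixed. **The heteroclinic orbit.** For each sufficiently small $\varepsilon>0$ there is a heteroclinic orbit $(w_{1,\varepsilon},w_{2,\varepsilon},\varphi_{1,\varepsilon},\varphi_{2,\varepsilon})$ of (S$_\varepsilon$), from $(0,0,\frac{\pi}{2},0)$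 (as $x\to-\infty$) to $(0,0,0,0)$ (as $x\to+\infty$), lying on $\mathcal{M}_\varepsilon$, with $\varphi_{1,\varepsilon}(0)=\frac{\pi}{4}$, $0<\varphi_{1,\varepsilon}<\frac{\pi}{2}$, $\varphi_{2,\varepsilon}<0$ on $\mathbb{R}$, and satisfying, uniformly in $x\in\mathbb{R}$ as $\varepsilon\to0$, \[ w_{1,\varepsilon}=\frac{\varphi_{2,\varepsilon}^2+\left(\frac{1}{\lambda^2}+1\right)\sin^2\varphi_{1,\varepsilon}\cos^2\varphi_{1,\varepsilon}}{2\left[1+\left(\frac{1}{\lambda^2}-1\right)\cos^2\varphi_{1,\varepsilon}\right]}+\mathcal{O}(\varepsilon)\min\{e^{2x/\lambda},e^{-2x}\}, \] \[ w_{2,\varepsilon}=\mathcal{O}(\varepsilon)\min\{e^{2x/\lambda},e^{-2x}\},\qquad \varphi_{i,\varepsilon}=\varphi_{i,0}+\mathcal{O}(\varepsilon)\min\{e^{x/\lambda},e^{-x}\},\ i=1,2. \] This is the orbit meant in the claim. *)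

theory Defs
  imports "HOL-Analysis.Analysis"
begin

section \<open>Functions of class $C^k$\<close>

text \<open>Intended for open sets only; see \<open>Ck_up_to\<close> for the others.\<close>

primrec Ck_on :: "nat \<Rightarrow> ('a::euclidean_space \<Rightarrow> real) \<Rightarrow> 'a set \<Rightarrow> bool" where
  "Ck_on 0 f S \<longleftrightarrow> continuous_on S f"
| "Ck_on (Suc k) f S \<longleftrightarrow>
     (\<forall>x\<in>S. f differentiable (at x)) \<and>
     (\<forall>v. Ck_on k (\<lambda>x. frechet_derivative f (at x) v) S)"

definition smooth_on :: "('a::euclidean_space \<Rightarrow> real) \<Rightarrow> 'a set \<Rightarrow> bool" where
  "smooth_on f S \<longleftrightarrow> (\<forall>k. Ck_on k f S)"

text \<open>
  $C^k(S)$ for a set that need not be open: restrictions to $S$ of $C^k$ functions on an open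
  neighbourhood of $S$.
\<close>

definition Ck_up_to :: "nat \<Rightarrow> ('a::euclidean_space \<Rightarrow> real) \<Rightarrow> 'a set \<Rightarrow> bool" where
  "Ck_up_to k f S \<longleftrightarrow>
     (\<exists>U F. open U \<and> S \<subseteq> U \<and> Ck_on k F U \<and> (\<forall>x\<in>S. F x = f x))"

text \<open>
  A domain with smooth boundary: near each boundary point it is the strict sublevel set of a
  smooth function without critical points.
\<close>

definition smooth_domain :: "'a::euclidean_space set \<Rightarrow> bool" where
  "smooth_domain D \<longleftrightarrow> open D \<and> connected D \<and>
     (\<forall>p\<in>frontier D. \<exists>U g. open U \<and> p \<in> U \<and> smooth_on g U \<and>
        (\<forall>q\<in>U. frechet_derivative g (at q) \<noteq> (\<lambda>_. 0)) \<and>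
        D \<inter> U = {q \<in> U. g q < 0})"

section \<open>The slow-fast system\<close>

text \<open>
  The requirement $1 - \varepsilon^2 w_1 \neq 0$ says that the right-hand side is defined
  (division by zero yields zero in HOL).
\<close>

definition solves_S ::
  "real \<Rightarrow> real \<Rightarrow> (real \<Rightarrow> real) \<Rightarrow> (real \<Rightarrow> real) \<Rightarrow> (real \<Rightarrow> real) \<Rightarrow> (real \<Rightarrow> real) \<Rightarrow> real set \<Rightarrow> bool"
where
  "solves_S lam eps w1 w2 p1 p2 J \<longleftrightarrow> (\<forall>x\<in>J.
     1 - eps\<^sup>2 * w1 x \<noteq> 0 \<and>
     (w1 has_real_derivative w2 x / eps) (at x within J) \<and>
     (w2 has_real_derivative
        (- (1 - eps\<^sup>2 * w1 x) * (p2 x)\<^sup>2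
         - (1 - eps\<^sup>2 * w1 x) * (eps\<^sup>2 * (w1 x)\<^sup>2 - 2 * w1 x)
             * (1 + (1 / lam\<^sup>2 - 1) * (cos (p1 x))\<^sup>2)
         - (1 - eps\<^sup>2 * w1 x) ^ 3 * (1 / lam\<^sup>2 + 1) * (sin (p1 x))\<^sup>2 * (cos (p1 x))\<^sup>2) / eps)
       (at x within J) \<and>
     (p1 has_real_derivative p2 x) (at x within J) \<and>
     (p2 has_real_derivative
        (2 * eps * w2 x * p2 x / (1 - eps\<^sup>2 * w1 x)
         + (1 - 1 / lam\<^sup>2) * (eps\<^sup>2 * (w1 x)\<^sup>2 - 2 * w1 x) * sin (p1 x) * cos (p1 x)
         + (1 - eps\<^sup>2 * w1 x)\<^sup>2
             * (sin (p1 x) * cos (p1 x) ^ 3 - 1 / lam\<^sup>2 * cos (p1 x) * sin (p1 x) ^ 3)))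
       (at x within J))"

definition limit_profile :: "real \<Rightarrow> (real \<Rightarrow> real) \<Rightarrow> bool" where
  "limit_profile lam f \<longleftrightarrow>
     (\<forall>x. (f has_real_derivative
        - 1 / (2 * lam) * sin (2 * f x) / sqrt (1 + (1 / lam\<^sup>2 - 1) * (cos (f x))\<^sup>2)) (at x)) \<and>
     (f \<longlongrightarrow> pi / 2) at_bot \<and> (f \<longlongrightarrow> 0) at_top \<and> f 0 = pi / 4"

section \<open>Slow manifolds\<close>

definition slow_region :: "(real \<Rightarrow> real) \<Rightarrow> (real \<times> real) set \<Rightarrow> bool" where
  "slow_region phi0 K \<longleftrightarrow> compact K \<and>
     (\<exists>D. smooth_domain D \<and> K = closure D \<and>
        range (\<lambda>x. (phi0 x, deriv phi0 x)) \<union> {(pi / 2, 0), (0, 0)} \<subseteq> D) \<and>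
     (\<forall>a b. (a, b) \<in> K \<longrightarrow> (- a, b) \<in> K \<and> (a, - b) \<in> K)"

definition critical_w1 :: "real \<Rightarrow> real \<Rightarrow> real \<Rightarrow> real" where
  "critical_w1 lam a b =
     (b\<^sup>2 + (1 / lam\<^sup>2 + 1) * (sin a)\<^sup>2 * (cos a)\<^sup>2) / (2 * (1 + (1 / lam\<^sup>2 - 1) * (cos a)\<^sup>2))"

text \<open>
  The part of the graph lying over \<open>A\<close>; the manifold is obtained for \<open>A = K\<close> and its boundary
  for \<open>A = frontier K\<close>.
\<close>

definition slow_graph ::
  "real \<Rightarrow> ((real \<times> real) \<times> real \<Rightarrow> real) \<Rightarrow> ((real \<times> real) \<times> real \<Rightarrow> real) \<Rightarrow> real \<Rightarrow>
   (real \<times> real) set \<Rightarrow> (real \<times> real \<times> real \<times> real) set"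
where
  "slow_graph lam h1 h2 eps A =
     {(critical_w1 lam a b + eps * h1 ((a, b), eps), eps * h2 ((a, b), eps), a, b) | a b.
        (a, b) \<in> A}"

text \<open>
  Following a solution from the point \<open>s\<close>, where it is on \<open>M\<close>, to \<open>t\<close> (in either direction), it
  is still on \<open>M\<close>, or has been on \<open>M\<close> until meeting the boundary \<open>dM\<close>.
\<close>

definition locally_invariant_S ::
  "real \<Rightarrow> real \<Rightarrow> (real \<times> real \<times> real \<times> real) set \<Rightarrow> (real \<times> real \<times> real \<times> real) set \<Rightarrow> bool"
where
  "locally_invariant_S lam eps M dM \<longleftrightarrow>
     (\<forall>w1 w2 p1 p2 s t.
        solves_S lam eps w1 w2 p1 p2 (closed_segment s t) \<and> (w1 s, w2 s, p1 s, p2 s) \<in> M \<longrightarrow>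
        (w1 t, w2 t, p1 t, p2 t) \<in> M \<or>
        (\<exists>r\<in>closed_segment s t. (w1 r, w2 r, p1 r, p2 r) \<in> dM \<and>
           (\<forall>q\<in>closed_segment s r. (w1 q, w2 q, p1 q, p2 q) \<in> M)))"

definition slow_manifold_family ::
  "real \<Rightarrow> nat \<Rightarrow> (real \<times> real) set \<Rightarrow> real \<Rightarrow>
   ((real \<times> real) \<times> real \<Rightarrow> real) \<Rightarrow> ((real \<times> real) \<times> real \<Rightarrow> real) \<Rightarrow> bool"
where
  "slow_manifold_family lam m K eps0 h1 h2 \<longleftrightarrow>
     eps0 > 0 \<and>
     (\<forall>h\<in>{h1, h2}. Ck_up_to m h (K \<times> {0..})) \<and>
     (\<forall>eps\<in>{0<..<eps0}.
        locally_invariant_S lam eps (slow_graph lam h1 h2 eps K)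
          (slow_graph lam h1 h2 eps (frontier K))) \<and>
     (\<forall>h\<in>{h1, h2}. \<forall>eps\<in>{0..<eps0}.
        h ((pi / 2, 0), eps) = 0 \<and> h ((0, 0), eps) = 0 \<and>
        (\<forall>(a, b)\<in>K. h ((- a, - b), eps) = h ((a, b), eps)))"

section \<open>The heteroclinic orbits\<close>

definition heteroclinic_orbit ::
  "real \<Rightarrow> real \<Rightarrow> (real \<times> real \<times> real \<times> real) set \<Rightarrow>
   (real \<Rightarrow> real) \<Rightarrow> (real \<Rightarrow> real) \<Rightarrow> (real \<Rightarrow> real) \<Rightarrow> (real \<Rightarrow> real) \<Rightarrow> bool"
where
  "heteroclinic_orbit lam eps M w1 w2 p1 p2 \<longleftrightarrow>
     solves_S lam eps w1 w2 p1 p2 UNIV \<and>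
     ((\<lambda>x. (w1 x, w2 x, p1 x, p2 x)) \<longlongrightarrow> (0, 0, pi / 2, 0)) at_bot \<and>
     ((\<lambda>x. (w1 x, w2 x, p1 x, p2 x)) \<longlongrightarrow> (0, 0, 0, 0)) at_top \<and>
     (\<forall>x. (w1 x, w2 x, p1 x, p2 x) \<in> M) \<and>
     p1 0 = pi / 4 \<and>
     (\<forall>x. 0 < p1 x \<and> p1 x < pi / 2 \<and> p2 x < 0)"

text \<open>The first argument of \<open>w1\<close>, \<open>w2\<close>, \<open>p1\<close>, \<open>p2\<close> is $\varepsilon$.\<close>

definition heteroclinic_family ::
  "real \<Rightarrow> (real \<Rightarrow> real) \<Rightarrow> (real \<Rightarrow> (real \<times> real \<times> real \<times> real) set) \<Rightarrow>
   (real \<Rightarrow> real \<Rightarrow> real) \<Rightarrow> (real \<Rightarrow> real \<Rightarrow> real) \<Rightarrow>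
   (real \<Rightarrow> real \<Rightarrow> real) \<Rightarrow> (real \<Rightarrow> real \<Rightarrow> real) \<Rightarrow> bool"
where
  "heteroclinic_family lam phi0 M w1 w2 p1 p2 \<longleftrightarrow>
     (\<forall>\<^sub>F eps in at_right 0.
        heteroclinic_orbit lam eps (M eps) (w1 eps) (w2 eps) (p1 eps) (p2 eps)) \<and>
     (\<exists>C. \<forall>\<^sub>F eps in at_right 0. \<forall>x.
        \<bar>w1 eps x - critical_w1 lam (p1 eps x) (p2 eps x)\<bar>
          \<le> C * eps * min (exp (2 * x / lam)) (exp (- 2 * x)) \<and>
        \<bar>w2 eps x\<bar> \<le> C * eps * min (exp (2 * x / lam)) (exp (- 2 * x)) \<and>
        \<bar>p1 eps x - phi0 x\<bar> \<le> C * eps * min (exp (x / lam)) (exp (- x)) \<and>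
        \<bar>p2 eps x - deriv phi0 x\<bar> \<le> C * eps * min (exp (x / lam)) (exp (- x)))"

section \<open>The space $W^{1,2}_{loc}(\mathbb{R})$\<close>

definition test_function :: "(real \<Rightarrow> real) \<Rightarrow> bool" where
  "test_function \<psi> \<longleftrightarrow> smooth_on \<psi> UNIV \<and> compact (closure {x. \<psi> x \<noteq> 0})"

definition locally_integrable :: "(real \<Rightarrow> real) \<Rightarrow> bool" where
  "locally_integrable f \<longleftrightarrow> (\<forall>a b. set_integrable lborel {a..b} f)"

definition locally_L2 :: "(real \<Rightarrow> real) \<Rightarrow> bool" where
  "locally_L2 f \<longleftrightarrow>
     f \<in> borel_measurable lborel \<and> (\<forall>a b. set_integrable lborel {a..b} (\<lambda>x. (f x)\<^sup>2))"

definition has_weak_deriv :: "(real \<Rightarrow> real) \<Rightarrow> (real \<Rightarrow> real) \<Rightarrow> bool" where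
  "has_weak_deriv f g \<longleftrightarrow> locally_integrable f \<and> locally_integrable g \<and>
     (\<forall>\<psi>. test_function \<psi> \<longrightarrow>
        (\<integral>x. f x * deriv \<psi> x \<partial>lborel) = - (\<integral>x. g x * \<psi> x \<partial>lborel))"

text \<open>Determined up to a null set only, which does not affect integrals.\<close>

definition weak_deriv :: "(real \<Rightarrow> real) \<Rightarrow> real \<Rightarrow> real" where
  "weak_deriv f = (SOME g. has_weak_deriv f g)"

text \<open>
  Every class in $W^{1,2}_{loc}(\mathbb{R})$ has exactly one continuous representative; we work
  with this one, so that pointwise limits at infinity and equality of functions make sense.
\<close>

definition W12_loc :: "(real \<Rightarrow> real) set" where
  "W12_loc = {f. continuous_on UNIV f \<and> locally_L2 f \<and>
     (\<exists>g. has_weak_deriv f g \<and> locally_L2 g)}"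

section \<open>The variational problem\<close>

definition connecting :: "(real \<Rightarrow> real) \<Rightarrow> (real \<Rightarrow> real) \<Rightarrow> bool" where
  "connecting u v \<longleftrightarrow>
     (u \<longlongrightarrow> 0) at_bot \<and> (v \<longlongrightarrow> 1) at_bot \<and> (u \<longlongrightarrow> 1) at_top \<and> (v \<longlongrightarrow> 0) at_top"

definition admissible :: "((real \<Rightarrow> real) \<times> (real \<Rightarrow> real)) set" where
  "admissible = {(u, v). u \<in> W12_loc \<and> v \<in> W12_loc \<and> connecting u v}"

text \<open>The integrand is nonnegative for $\Lambda \geq 1$; the energy may be infinite.\<close>

definition energy :: "real \<Rightarrow> real \<Rightarrow> (real \<Rightarrow> real) \<times> (real \<Rightarrow> real) \<Rightarrow> ennreal" where
  "energy lam Lam = (\<lambda>(u, v). \<integral>\<^sup>+z. ennreal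
     (lam\<^sup>2 * (weak_deriv u z)\<^sup>2 / 2 + (weak_deriv v z)\<^sup>2 / 2
      + (1 - (u z)\<^sup>2 - (v z)\<^sup>2)\<^sup>2 / 4 + (Lam - 1) / 2 * (u z)\<^sup>2 * (v z)\<^sup>2) \<partial>lborel)"

definition minimizer :: "real \<Rightarrow> real \<Rightarrow> (real \<Rightarrow> real) \<times> (real \<Rightarrow> real) \<Rightarrow> bool" where
  "minimizer lam Lam p \<longleftrightarrow>
     p \<in> admissible \<and> (\<forall>q\<in>admissible. energy lam Lam p \<le> energy lam Lam q)"

definition heteroclinic_connection ::
  "real \<Rightarrow> real \<Rightarrow> (real \<Rightarrow> real) \<Rightarrow> (real \<Rightarrow> real) \<Rightarrow> bool"
where
  "heteroclinic_connection lam Lam u v \<longleftrightarrow>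
     (\<forall>z. u differentiable (at z) \<and> deriv u differentiable (at z) \<and>
          v differentiable (at z) \<and> deriv v differentiable (at z) \<and>
          lam\<^sup>2 * deriv (deriv u) z = u z ^ 3 - u z + Lam * (v z)\<^sup>2 * u z \<and>
          deriv (deriv v) z = v z ^ 3 - v z + Lam * (u z)\<^sup>2 * v z) \<and>
     connecting u v"

end

theory Submission
  imports Defs
begin

text \<open>
  The heteroclinic orbit yields a solution $(u,v)$ with $\dot u>0>\dot v$: the asymptotics of the
  orbit dominate the terms involving $w_2$, uniformly up to $\pm\infty$. Monotonicity alone gives
  minimality and uniqueness, by a calibration. Write $\dot u=p(u)$ and $\dot v=q(v)$, and let $W$ be
  the potential. Completing squares,
  \[ E_\Lambda(U,V)=C+\int \frac{\lambda^2}{2}(\dot U-p(U))^2+\frac12(\dot V-q(V))^2+G(U,V), \qquad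
     G(U,V)=W(U,V)-\frac{\lambda^2}{2}p(U)^2-\frac12q(V)^2, \]
  where $C$ only depends on the end states, as $p(U)\dot U$ and $q(V)\dot V$ are exact derivatives. By
  conservation of the Hamiltonian, $G(u(t),v(t))=0$, while
  \[ \frac{\partial}{\partial s}G(u(s),v(t))=\Lambda\,\dot u(s)\,u(s)\,(v(t)^2-v(s)^2) \]
  has the sign of $s-t$, so that $G\geq0$ with equality only for $s=t$. Hence $(u,v)$ minimizes, and a
  minimizer solves $\dot U=p(U)$, $\dot V=q(V)$ with equal phases, i.e. is a translate of $(u,v)$.
\<close>

section \<open>Smooth cut-off functions\<close>

text \<open>The obstacles are of regularity. Competitors are only weakly differentiable, and a weak
  derivative is known solely through smooth test functions; explicit cut-offs are built to recover
  the fundamental theorem, almost-everywhere uniqueness and a chain rule. Competitors may also leave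
  the unit square or have infinite energy: the speeds p and q are extended by zero, G >= 0 is shown
  on the whole plane, and the energy identity is obtained on bounded intervals and passed to the
  limit in \<open>ennreal\<close>. The extended speeds are only known to be continuous, so U' = p(U)
  is not treated through a Lipschitz condition but by inverting the profile where U lies strictly
  between 0 and 1. Monotonicity is delicate at the ends, where both terms of the derivatives of u
  and v vanish. With mu = min(exp(x/lambda), exp(-x)), the products of phi_2 with sin phi_1 and cos
  phi_1 are at least of order mu^2 in size, and mu^2 is exactly the decay rate available for w_2; a
  small factor therefore decides the sign for all x at once.\<close>

text \<open>
  The polynomial and the exponent make this family of smooth functions supported in the unit
  interval closed under differentiation.
\<close>

definition bump :: "real poly \<Rightarrow> nat \<Rightarrow> real \<Rightarrow> real" where
  "bump A k x =
     (if 0 < x \<and> x < 1 then poly A x * (1 / (x * (1 - x))) ^ k * exp (- (1 / (x * (1 - x)))) else 0)"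

lemma power_div_fact_le_exp:
  fixes y :: real
  assumes "y \<ge> 0"
  shows "y ^ n / fact n \<le> exp y"
proof -
  have s: "summable (\<lambda>n. y ^ n / fact n)" and e: "exp y = (\<Sum>n. y ^ n / fact n)"
    using exp_converges[of y] by (auto simp: sums_iff divide_inverse mult.commute)
  have "(\<Sum>i\<in>{n}. y ^ i / fact i) \<le> (\<Sum>n. y ^ n / fact n)"
    using assms by (intro sum_le_suminf s) auto
  then show ?thesis using e by simp
qed

text \<open>This is what makes the derivative vanish at 0 and 1. With s = t(1 - t) and y = 1/s, one
  term of the exponential series gives y^k exp(-y) <= (k + 2)! s^2, and s is at most the distance
  from t to any point outside the open interval.\<close>

lemma bump_quadratic_bound:
  "\<exists>C. \<forall>t x. \<not> (0 < x \<and> x < 1) \<longrightarrow> \<bar>bump A k t\<bar> \<le> C * (t - x)\<^sup>2"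
proof -
  have "bounded (poly A ` {0..1})"
    by (intro compact_imp_bounded compact_continuous_image continuous_intros) auto
  then obtain M where M: "\<And>t. 0 \<le> t \<Longrightarrow> t \<le> 1 \<Longrightarrow> \<bar>poly A t\<bar> \<le> M"
    unfolding bounded_iff by fastforce
  have "\<bar>bump A k t\<bar> \<le> M * fact (k + 2) * (t - x)\<^sup>2" if x: "\<not> (0 < x \<and> x < 1)" for t x
  proof (cases "0 < t \<and> t < 1")
    case t: True
    define s where "s = t * (1 - t)"
    define y where "y = 1 / s"
    have s: "0 < s" "y > 0" using t by (auto simp: s_def y_def)
    have st: "s\<^sup>2 \<le> (t - x)\<^sup>2"
    proof -
      have "s \<le> t" "s \<le> 1 - t" using t mult_left_le[of "1 - t" t] mult_left_le[of t "1 - t"] by (auto simp: s_def mult.commute)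
      then have "s \<le> \<bar>t - x\<bar>" using x t by linarith
      then show ?thesis using s by (simp add: abs_le_square_iff[symmetric])
    qed
    have "y ^ k * exp (- y) * y\<^sup>2 = y ^ (k + 2) / exp y"
      by (simp add: exp_minus power_add power2_eq_square field_simps)
    also have "\<dots> \<le> fact (k + 2)"
      using power_div_fact_le_exp[of y "k + 2"] s by (simp add: field_simps del: fact_Suc)
    finally have "y ^ k * exp (- y) \<le> fact (k + 2) * s\<^sup>2"
      using s by (simp add: y_def field_simps del: fact_Suc)
    also have "\<dots> \<le> fact (k + 2) * (t - x)\<^sup>2" using st by (intro mult_left_mono) auto
    finally have 1: "y ^ k * exp (- y) \<le> fact (k + 2) * (t - x)\<^sup>2" .
    have "\<bar>bump A k t\<bar> = \<bar>poly A t\<bar> * (y ^ k * exp (- y))"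
      using t s by (simp add: bump_def y_def s_def abs_mult)
    also have "\<dots> \<le> M * (fact (k + 2) * (t - x)\<^sup>2)"
      using t s by (intro mult_mono M 1) (use M[of t] in auto)
    finally show ?thesis by (simp add: mult.assoc)
  next
    case False
    have "0 \<le> M" using M[of 0] by auto
    then show ?thesis using False by (auto simp: bump_def)
  qed
  then show ?thesis by blast
qed

text \<open>For y = 1/(x(1 - x)) one has y' = -(1 - 2x) y^2. Factoring out y^(k + 2) leaves powers
  of 1/y = x(1 - x), the polynomial \<open>[:0, 1, -1:]\<close>, so the cofactor is again a
  polynomial.\<close>

lemma DERIV_bump:
  "(bump A k has_real_derivative
     bump (pderiv A * [:0, 1, -1:]\<^sup>2 - smult (real k) (A * [:1, -2:] * [:0, 1, -1:]) + A * [:1, -2:])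
       (k + 2) x) (at x)"
proof (cases "0 < x \<and> x < 1")
  case True
  have nz: "x * (1 - x) \<noteq> 0" using True by auto
  have ev: "\<forall>\<^sub>F t in nhds x. 0 < t \<and> t < 1"
    using True eventually_nhds_in_open[of "{0<..<1}" x] by simp
  define f where "f = (\<lambda>t. poly A t * (1 / (t * (1 - t))) ^ k * exp (- (1 / (t * (1 - t)))))"
  have "(f has_real_derivative
     bump (pderiv A * [:0, 1, -1:]\<^sup>2 - smult (real k) (A * [:1, -2:] * [:0, 1, -1:]) + A * [:1, -2:])
       (k + 2) x) (at x)"
  proof -
    define y where "y = 1 / (x * (1 - x))"
    have y: "x * (1 - x) = 1 / y" "y \<noteq> 0" using nz by (auto simp: y_def)
    have d1: "((\<lambda>t. 1 / (t * (1 - t))) has_real_derivative (- (1 - 2 * x) * y\<^sup>2)) (at x)"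
      using True nz unfolding y_def
      by (auto intro!: derivative_eq_intros simp: field_simps power2_eq_square)
    have "(f has_real_derivative
        (poly (pderiv A) x * y ^ k + poly A x * (real k * y ^ (k - 1) * (- (1 - 2 * x) * y\<^sup>2))) * exp (- y) +
        poly A x * y ^ k * (exp (- y) * - (- (1 - 2 * x) * y\<^sup>2))) (at x)"
      unfolding f_def
      by (rule derivative_eq_intros d1 poly_DERIV refl)+ (simp add: y_def)
    \<comment> \<open>For \<open>k = 0\<close> the exponent \<open>k - 1\<close> is truncated to 0,
      but the factor \<open>real k\<close> annihilates the term.\<close>
    moreover have "real k * y ^ (k - 1) * (- (1 - 2 * x) * y\<^sup>2) = - real k * y ^ k * y * (1 - 2 * x)"
      by (cases k) (simp_all add: power2_eq_square field_simps)
    then have "(poly (pderiv A) x * y ^ k + poly A x * (real k * y ^ (k - 1) * (- (1 - 2 * x) * y\<^sup>2))) * exp (- y) +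
        poly A x * y ^ k * (exp (- y) * - (- (1 - 2 * x) * y\<^sup>2)) =
      (poly (pderiv A) x * (1 / y)\<^sup>2 - real k * (poly A x * (1 - 2 * x) * (1 / y)) + poly A x * (1 - 2 * x)) *
      y ^ (k + 2) * exp (- y)"
      using y(2) by (simp only:) (simp add: field_simps power2_eq_square)
    also have "\<dots> = bump (pderiv A * [:0, 1, -1:]\<^sup>2 - smult (real k) (A * [:1, -2:] * [:0, 1, -1:]) + A * [:1, -2:])
       (k + 2) x"
      using True by (simp add: bump_def y(1)[symmetric] flip: y_def) (simp add: algebra_simps power2_eq_square)
    ultimately show ?thesis by simp
  qed
  moreover have "\<forall>\<^sub>F t in nhds x. bump A k t = f t"
    using ev by eventually_elim (simp add: bump_def f_def)
  ultimately show ?thesis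
    using DERIV_cong_ev[OF refl _ refl] by blast
next
  case False
  obtain C where C: "\<And>t. \<bar>bump A k t\<bar> \<le> C * (t - x)\<^sup>2"
    using bump_quadratic_bound[of A k] False by blast
  have "((\<lambda>t. (bump A k t - bump A k x) / (t - x)) \<longlongrightarrow> 0) (at x)"
  proof (rule Lim_null_comparison)
    show "\<forall>\<^sub>F t in at x. norm ((bump A k t - bump A k x) / (t - x)) \<le> C * \<bar>t - x\<bar>"
    proof (rule eventually_at[THEN iffD2], intro exI[of _ 1] conjI ballI impI)
      fix t assume "t \<noteq> x \<and> dist t x < 1"
      then show "norm ((bump A k t - bump A k x) / (t - x)) \<le> C * \<bar>t - x\<bar>"
        using C[of t] False by (auto simp: bump_def power2_eq_square abs_mult divide_le_eq mult.assoc abs_mult_self_eq)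
    qed auto
    have "((\<lambda>t. C * \<bar>t - x\<bar>) \<longlongrightarrow> C * \<bar>x - x\<bar>) (at x)" by (intro tendsto_intros)
    then show "((\<lambda>t. C * \<bar>t - x\<bar>) \<longlongrightarrow> 0) (at x)" by simp
  qed
  then have "(bump A k has_real_derivative 0) (at x)" by (simp add: has_field_derivative_iff)
  moreover have "bump B (k + 2) x = 0" for B using False by (auto simp: bump_def)
  ultimately show ?thesis by simp
qed

lemma continuous_bump: "continuous_on UNIV (bump A k)"
  using DERIV_bump DERIV_isCont by (blast intro: continuous_at_imp_continuous_on)

text \<open>\<open>Ck_on\<close> asks for every directional derivative; the direction enters as a
  scalar, absorbed by \<open>c\<close> and \<open>d\<close>. \<open>A\<close> and \<open>k\<close>
  stay arbitrary in the induction because differentiation changes them. The two shifts give the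
  shape of the derivatives of the cut-offs used below.\<close>

lemma Ck_on_bump_combination:
  "Ck_on n (\<lambda>x. c * bump A k (r * x + s) + d * bump A k (r * x + t)) UNIV"
proof (induction n arbitrary: c d A k)
  case 0
  then show ?case
    by (auto intro!: continuous_intros continuous_on_compose2[OF continuous_bump])
next
  case (Suc n)
  let ?f = "\<lambda>x. c * bump A k (r * x + s) + d * bump A k (r * x + t)"
  obtain B where B: "\<And>x. (bump A k has_real_derivative bump B (k + 2) x) (at x)" using DERIV_bump by blast
  let ?g = "\<lambda>x. c * r * bump B (k + 2) (r * x + s) + d * r * bump B (k + 2) (r * x + t)"
  have D: "(?f has_real_derivative ?g x) (at x)" for x
    by (auto intro!: derivative_eq_intros DERIV_chain2[OF B])
  have "frechet_derivative ?f (at x) v =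
     (c * r * v) * bump B (k + 2) (r * x + s) + (d * r * v) * bump B (k + 2) (r * x + t)" for x v
  proof -
    have "(?f has_derivative (\<lambda>v. ?g x * v)) (at x)" using D[of x] by (simp add: has_field_derivative_def)
    then have "frechet_derivative ?f (at x) = (\<lambda>v. ?g x * v)" by (rule frechet_derivative_at[symmetric])
    then show ?thesis by (simp only: distrib_right mult.assoc mult.commute[of _ v] mult.left_commute[of _ v])
  qed
  moreover have "?f differentiable (at x)" for x using D real_differentiable_def by blast
  ultimately show ?case by (simp only: Ck_on.simps Suc.IH) simp
qed

lemma antiderivative_exists:
  fixes f :: "real \<Rightarrow> real"
  assumes "continuous_on UNIV f"
  obtains F where "\<And>x. (F has_real_derivative f x) (at x)"
proof -
  have "\<exists>F. \<forall>x::real. -\<infinity> < ereal x \<longrightarrow> ereal x < \<infinity> \<longrightarrow> (F has_vector_derivative f x) (at x)"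
    using assms by (intro einterval_antiderivative) (auto simp: continuous_on_eq_continuous_at)
  then show ?thesis using that by (auto simp: has_real_derivative_iff_has_vector_derivative)
qed

text \<open>A normalized primitive of exp(-1/(x(1 - x))). It is used twice: the step itself builds
  cut-offs, and its derivative is a nonnegative mollifier of mass one.\<close>

lemma smooth_step_exists:
  obtains S :: "real \<Rightarrow> real" and c where "\<And>x. (S has_real_derivative c * bump 1 0 x) (at x)"
    "\<And>x. x \<le> 0 \<Longrightarrow> S x = 0" "\<And>x. x \<ge> 1 \<Longrightarrow> S x = 1" "\<And>x. 0 \<le> S x \<and> S x \<le> 1" "c > 0"
proof -
  obtain B where B: "\<And>x. (B has_real_derivative bump 1 0 x) (at x)"
    using antiderivative_exists[OF continuous_bump] by blast
  have nonneg: "bump 1 0 x \<ge> 0" for x by (auto simp: bump_def)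
  have mono: "B x \<le> B y" if "x \<le> y" for x y
    using that B nonneg by (intro DERIV_nonneg_imp_nondecreasing[OF that]) blast
  have lo: "B x = B 0" if "x \<le> 0" for x
  proof (cases "x < 0")
    case True
    then obtain z where "x < z" "z < 0" "B 0 - B x = (0 - x) * bump 1 0 z"
      using MVT2[of x 0 B "bump 1 0"] B by blast
    then show ?thesis by (simp add: bump_def)
  qed (use that in auto)
  have hi: "B x = B 1" if "x \<ge> 1" for x
  proof (cases "x > 1")
    case True
    then obtain z where "1 < z" "z < x" "B x - B 1 = (x - 1) * bump 1 0 z"
      using MVT2[of 1 x B "bump 1 0"] B by blast
    then show ?thesis by (simp add: bump_def)
  qed (use that in auto)
  have lt: "B 0 < B 1"
  proof -
    obtain z where "0 < z" "z < 1" "B 1 - B 0 = (1 - 0) * bump 1 0 z"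
      using MVT2[of 0 1 B "bump 1 0"] B by auto
    moreover from this have "bump 1 0 z > 0" by (simp add: bump_def)
    ultimately have "0 < B 1 - B 0" by (simp only: diff_zero mult_1)
    then show ?thesis by (simp only: diff_gt_0_iff_gt)
  qed
  define S where "S = (\<lambda>x. (B x - B 0) / (B 1 - B 0))"
  have range: "B 0 \<le> B x \<and> B x \<le> B 1" for x
    using lo[of x] hi[of x] mono[of 0 x] mono[of x 1] lt by linarith
  show ?thesis
  proof (rule that[of S "1 / (B 1 - B 0)"])
    show "(S has_real_derivative 1 / (B 1 - B 0) * bump 1 0 x) (at x)" for x
      unfolding S_def using lt by (auto intro!: derivative_eq_intros B)
    show "S x = 0" if "x \<le> 0" for x using lo[OF that] by (simp add: S_def)
    show "S x = 1" if "x \<ge> 1" for x using hi[OF that] lt by (simp add: S_def)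
    show "0 \<le> S x \<and> S x \<le> 1" for x using range[of x] lt by (simp add: S_def)
  qed (use lt in simp)
qed

text \<open>A step up followed by an equally steep step down is a plateau, the test function adapted
  to an interval. The primitive is not itself a \<open>bump\<close>, so one differentiation is done
  by hand before closure under derivatives applies.\<close>

lemma smooth_on_bump_primitive:
  assumes "\<And>x. (S has_real_derivative c * bump A k x) (at x)"
  shows "smooth_on (\<lambda>x. S (r * x + s) - S (r * x + t)) UNIV"
  unfolding smooth_on_def
proof
  fix n
  let ?f = "\<lambda>x. S (r * x + s) - S (r * x + t)"
  let ?g = "\<lambda>x. c * bump A k (r * x + s) * r - c * bump A k (r * x + t) * r"
  have D: "(?f has_real_derivative ?g x) (at x)" for x
    by (auto intro!: derivative_eq_intros DERIV_chain2[OF assms])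
  show "Ck_on n ?f UNIV"
  proof (cases n)
    case 0
    have "continuous_on UNIV ?f" using DERIV_isCont[OF D] by (simp add: continuous_at_imp_continuous_on)
    then show ?thesis unfolding 0 by simp
  next
    case (Suc j)
    have "frechet_derivative ?f (at x) v =
       (c * r * v) * bump A k (r * x + s) + (- c * r * v) * bump A k (r * x + t)" for x v
    proof -
      have "(?f has_derivative (\<lambda>v. ?g x * v)) (at x)" using D[of x] by (simp add: has_field_derivative_def)
      then have "frechet_derivative ?f (at x) v = ?g x * v" by (rule frechet_derivative_at[symmetric, THEN fun_cong])
      also have "\<dots> = (c * r * v) * bump A k (r * x + s) + (- c * r * v) * bump A k (r * x + t)"
        by (simp add: algebra_simps)
      finally show ?thesis .
    qed
    moreover have "?f differentiable (at x)" for x using D real_differentiable_def by blast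
    ultimately show ?thesis unfolding Suc by (simp only: Ck_on.simps Ck_on_bump_combination) simp
  qed
qed

section \<open>Weak derivatives\<close>

text \<open>The substitution x = a + y/N turns the kernel into the fixed density \<open>b\<close>
  and moves the scaling into the argument of \<open>f\<close>. Dominated convergence applies because
  only the values of \<open>f\<close> on [a, a + 1] occur.\<close>

lemma mollification_tendsto:
  fixes f :: "real \<Rightarrow> real"
  assumes f: "continuous_on UNIV f"
    and b: "integrable lborel b" "(\<integral>x. b x \<partial>lborel) = 1" "\<And>x. b x \<ge> 0" "\<And>x. \<not> (0 < x \<and> x < 1) \<Longrightarrow> b x = 0"
  shows "(\<lambda>n. \<integral>x. f x * (real (Suc n) * b (real (Suc n) * (x - a))) \<partial>lborel) \<longlonglongrightarrow> f a"
    and "integrable lborel (\<lambda>x. f x * (real (Suc n) * b (real (Suc n) * (x - a))))"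
proof -
  have [measurable]: "f \<in> borel_measurable lborel" "b \<in> borel_measurable lborel"
    using f b(1) by (auto intro: borel_measurable_continuous_onI)
  have "bounded (f ` {a..a + 1})"
    by (intro compact_imp_bounded compact_continuous_image continuous_on_subset[OF f]) auto
  then obtain M where M: "\<And>x. a \<le> x \<Longrightarrow> x \<le> a + 1 \<Longrightarrow> \<bar>f x\<bar> \<le> M" unfolding bounded_iff by fastforce
  let ?N = "\<lambda>n. real (Suc n)"
  have bnd: "AE x in lborel. norm (f (a + x / ?N n) * b x) \<le> M * b x" for n
  proof (rule AE_I2)
    fix x
    show "norm (f (a + x / ?N n) * b x) \<le> M * b x"
    proof (cases "0 < x \<and> x < 1")
      case True
      then have "x / ?N n \<le> 1" by (auto simp: divide_le_eq)
      then have "\<bar>f (a + x / ?N n)\<bar> \<le> M" using True by (intro M) auto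
      then show ?thesis using b(3)[of x] by (auto simp: abs_mult intro: mult_right_mono)
    qed (simp add: b(4))
  qed
  have lim: "AE x in lborel. (\<lambda>n. f (a + x / ?N n) * b x) \<longlonglongrightarrow> f a * b x"
  proof (rule AE_I2)
    fix x
    have "(\<lambda>n. x * inverse (?N n)) \<longlonglongrightarrow> x * 0" by (intro tendsto_intros LIMSEQ_inverse_real_of_nat)
    then have "(\<lambda>n. a + x / ?N n) \<longlonglongrightarrow> a + 0" by (intro tendsto_intros) (simp add: divide_inverse)
    then have "(\<lambda>n. f (a + x / ?N n)) \<longlonglongrightarrow> f a"
      using f by (auto simp: continuous_on_eq_continuous_at intro: isCont_tendsto_compose)
    then show "(\<lambda>n. f (a + x / ?N n) * b x) \<longlonglongrightarrow> f a * b x" by (intro tendsto_intros)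
  qed
  have w: "integrable lborel (\<lambda>x. M * b x)" using b(1) by simp
  have "(\<lambda>n. \<integral>x. f (a + x / ?N n) * b x \<partial>lborel) \<longlonglongrightarrow> (\<integral>x. f a * b x \<partial>lborel)"
    by (rule integral_dominated_convergence[OF _ _ w lim bnd]) auto
  moreover have i: "integrable lborel (\<lambda>x. f (a + x / ?N n) * b x)" for n
    by (rule Bochner_Integration.integrable_bound[OF w]) (use bnd[of n] in auto)
  moreover have e: "(\<integral>x. f x * (?N n * b (?N n * (x - a))) \<partial>lborel) = (\<integral>x. f (a + x / ?N n) * b x \<partial>lborel)" for n
    by (subst lborel_integral_real_affine[of "1 / ?N n" _ a]) (auto simp: mult.left_commute[of _ "?N n"] simp del: of_nat_Suc)
  ultimately show "(\<lambda>n. \<integral>x. f x * (?N n * b (?N n * (x - a))) \<partial>lborel) \<longlonglongrightarrow> f a"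
    using b(2) by simp
  have "integrable lborel (\<lambda>x. f (a + 1 / ?N n * x) * (?N n * b (?N n * ((a + 1 / ?N n * x) - a))))"
    using integrable_mult_right[OF i[of n], of "?N n"] by (simp add: mult.left_commute del: of_nat_Suc)
  then show "integrable lborel (\<lambda>x. f x * (?N n * b (?N n * (x - a))))"
    by (subst (asm) lborel_integrable_real_affine_iff) auto
qed

text \<open>The test function \<open>p n\<close> steps up just after \<open>a\<close> and down just
  after \<open>b\<close>. Its derivative is a difference of two mollifiers, so one side of the
  defining identity tends to \<open>f a - f b\<close>, while on the other \<open>p n\<close> tends
  to the indicator of the interval.\<close>

lemma weak_deriv_FTC:
  assumes f: "continuous_on UNIV f" and w: "has_weak_deriv f g" and ab: "a \<le> b"
  shows "(LINT t:{a..b}|lborel. g t) = f b - f a"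
proof -
  obtain S :: "real \<Rightarrow> real" and c where S: "\<And>x. (S has_real_derivative c * bump 1 0 x) (at x)"
    "\<And>x. x \<le> 0 \<Longrightarrow> S x = 0" "\<And>x. x \<ge> 1 \<Longrightarrow> S x = 1" "\<And>x. 0 \<le> S x \<and> S x \<le> 1" "c > 0"
    using smooth_step_exists by blast
  let ?b = "\<lambda>x. c * bump 1 0 x" and ?N = "\<lambda>n. real (Suc n)"
  have "has_bochner_integral lborel (\<lambda>x. ?b x * indicator {0..1} x) (S 1 - S 0)"
    by (intro has_bochner_integral_FTC_Icc_real S(1) continuous_intros)
       (auto intro: DERIV_isCont[OF DERIV_bump])
  moreover have "?b x * indicator {0..1} x = ?b x" for x by (auto simp: bump_def indicator_def)
  ultimately have bint: "integrable lborel ?b" "(\<integral>x. ?b x \<partial>lborel) = 1"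
    using S(2)[of 0] S(3)[of 1] by (auto simp: has_bochner_integral_iff)
  have b0: "?b x \<ge> 0" "\<not> (0 < x \<and> x < 1) \<Longrightarrow> ?b x = 0" for x using S(5) by (auto simp: bump_def)
  note moll = mollification_tendsto[OF f bint b0]
  define p where "p n x = S (?N n * (x - a)) - S (?N n * (x - b))" for n x
  have pd: "(p n has_real_derivative ?N n * ?b (?N n * (x - a)) - ?N n * ?b (?N n * (x - b))) (at x)" for n x
    unfolding p_def[abs_def]
    by (rule derivative_eq_intros DERIV_chain2[OF S(1)] refl)+ (simp add: algebra_simps)
  \<comment> \<open>The steps have width 1/N <= 1, so all supports lie in [a, b + 1]; this provides
    a dominating function independent of \<open>n\<close>.\<close>
  have p0: "p n x = 0" if "x < a \<or> x > b + 1" for n x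
  proof -
    have "?N n * (x - a) \<ge> 1" "?N n * (x - b) \<ge> 1" if "x > b + 1"
      using that ab mult_mono[of 1 "?N n" 1 "x - a"] mult_mono[of 1 "?N n" 1 "x - b"] by auto
    moreover have "?N n * (x - a) \<le> 0" "?N n * (x - b) \<le> 0" if "x < a"
      using that ab by (auto simp: mult_le_0_iff)
    ultimately show ?thesis using that S(2,3) by (auto simp: p_def)
  qed
  have p_bound: "\<bar>p n x\<bar> \<le> indicator {a..b + 1} x" for n x
    using p0[of x n] S(4)[of "?N n * (x - a)"] S(4)[of "?N n * (x - b)"]
    by (cases "x < a \<or> x > b + 1") (auto simp: indicator_def p_def)
  have test: "test_function (p n)" for n
    unfolding test_function_def
  proof
    have e: "p n = (\<lambda>x. S (?N n * x + - (?N n * a)) - S (?N n * x + - (?N n * b)))"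
      by (simp add: p_def fun_eq_iff right_diff_distrib del: of_nat_Suc)
    show "smooth_on (p n) UNIV" by (subst e) (rule smooth_on_bump_primitive[OF S(1)])
    have "bounded {x. p n x \<noteq> 0}"
    proof (rule bounded_subset[of "{a..b + 1}"])
      show "{x. p n x \<noteq> 0} \<subseteq> {a..b + 1}"
      proof
        show "x \<in> {a..b + 1}" if "x \<in> {x. p n x \<noteq> 0}" for x
          using that p0[of x n] by (cases "x < a \<or> x > b + 1") simp_all
      qed
    qed simp
    then show "compact (closure {x. p n x \<noteq> 0})" by (simp add: compact_closure)
  qed
  have gl: "set_integrable lborel {a..b + 1} g" using w by (auto simp: has_weak_deriv_def locally_integrable_def)
  have lim: "(\<lambda>n. (\<integral>x. f x * deriv (p n) x \<partial>lborel)) \<longlonglongrightarrow> f a - f b"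
  proof -
    have e: "f x * deriv (p n) x =
        f x * (?N n * ?b (?N n * (x - a))) - f x * (?N n * ?b (?N n * (x - b)))" for n x
      unfolding DERIV_imp_deriv[OF pd] by (rule right_diff_distrib)
    have "(\<integral>x. f x * deriv (p n) x \<partial>lborel) = (\<integral>x. f x * (?N n * ?b (?N n * (x - a))) \<partial>lborel)
       - (\<integral>x. f x * (?N n * ?b (?N n * (x - b))) \<partial>lborel)" for n
      unfolding e by (rule Bochner_Integration.integral_diff[OF moll(2) moll(2)])
    then show ?thesis using tendsto_diff[OF moll(1)[of a] moll(1)[of b]] by simp
  qed
  have "(\<lambda>n. (\<integral>x. g x * p n x \<partial>lborel)) \<longlonglongrightarrow> (LINT t:{a..b}|lborel. g t)"
    unfolding set_lebesgue_integral_def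
  proof (rule integral_dominated_convergence)
    have gi: "integrable lborel (\<lambda>x. indicator {a..b + 1} x * g x)"
      using gl by (simp add: set_integrable_def)
    show "integrable lborel (\<lambda>x. \<bar>indicator {a..b + 1} x * g x\<bar>)" using gi by simp
    have "(\<lambda>x. indicator {a..b} x *\<^sub>R g x) = (\<lambda>x. indicator {a..b} x * (indicator {a..b + 1} x * g x))"
      by (auto simp: fun_eq_iff indicator_def)
    also have "\<dots> \<in> borel_measurable lborel"
      by (intro borel_measurable_times borel_measurable_integrable[OF gi] borel_measurable_indicator) auto
    finally show "(\<lambda>x. indicator {a..b} x *\<^sub>R g x) \<in> borel_measurable lborel" .
    have pm: "p n \<in> borel_measurable lborel" for n
      using DERIV_isCont[OF pd] by (simp add: borel_measurable_continuous_onI continuous_at_imp_continuous_on)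
    have gp: "(\<lambda>x. g x * p n x) = (\<lambda>x. (indicator {a..b + 1} x * g x) * p n x)" for n
    proof
      show "g x * p n x = (indicator {a..b + 1} x * g x) * p n x" for x
        using p0[of x n] by (cases "x < a \<or> x > b + 1") (simp_all add: indicator_def)
    qed
    show "(\<lambda>x. g x * p n x) \<in> borel_measurable lborel" for n
      by (subst gp) (intro borel_measurable_times borel_measurable_integrable[OF gi] pm)
    have "norm (g x * p n x) \<le> \<bar>indicator {a..b + 1} x * g x\<bar>" for n x
    proof -
      have "norm (g x * p n x) = \<bar>g x\<bar> * \<bar>p n x\<bar>" by (simp add: abs_mult)
      also have "\<dots> \<le> \<bar>g x\<bar> * indicator {a..b + 1} x" using p_bound by (rule mult_left_mono) simp
      finally show ?thesis by (simp add: abs_mult mult.commute)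
    qed
    then show "AE x in lborel. norm (g x * p n x) \<le> \<bar>indicator {a..b + 1} x * g x\<bar>" for n by simp
    \<comment> \<open>At \<open>a\<close> every \<open>p n\<close> vanishes, whereas the indicator
      of the closed interval is 1 there. For a < b the point \<open>b\<close> is harmless, since the
      step down only begins at it.\<close>
    have "AE x in lborel. x \<noteq> a" by (rule AE_lborel_singleton)
    then show "AE x in lborel. (\<lambda>n. g x * p n x) \<longlonglongrightarrow> indicator {a..b} x *\<^sub>R g x"
    proof eventually_elim
      case (elim x)
      have up: "\<forall>\<^sub>F n in sequentially. S (?N n * d) = 1" if d: "d > 0" for d
      proof -
        obtain n0 where "real n0 * d > 1" using reals_Archimedean3[OF d] by blast
        have "?N n * d \<ge> 1" if "n \<ge> n0" for n
        proof -
          have "real n0 * d \<le> ?N n * d" using that d by (intro mult_right_mono) auto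
          then show ?thesis using \<open>real n0 * d > 1\<close> by linarith
        qed
        then show ?thesis using S(3) by (auto simp: eventually_sequentially)
      qed
      have lo: "S (?N n * d) = 0" if "d \<le> 0" for d n
        using that by (intro S(2) mult_nonneg_nonpos) auto
      have "\<forall>\<^sub>F n in sequentially. g x * p n x = indicator {a..b} x *\<^sub>R g x"
      proof (cases "x < a")
        case True
        then show ?thesis by (simp add: p0)
      next
        case False
        then have xa: "x - a > 0" using elim by auto
        show ?thesis
        proof (cases "x \<le> b")
          case True
          show ?thesis using up[OF xa] by eventually_elim (use lo[of "x - b"] True xa in \<open>auto simp: p_def\<close>)
        next
          case False
          then have "x - b > 0" by simp
          show ?thesis using up[OF xa] up[OF \<open>x - b > 0\<close>]
            by eventually_elim (use False in \<open>auto simp: p_def\<close>)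
        qed
      qed
      then show ?case by (rule tendsto_eventually)
    qed
  qed
  then have "(\<lambda>n. - (\<integral>x. g x * p n x \<partial>lborel)) \<longlonglongrightarrow> - (LINT t:{a..b}|lborel. g t)"
    by (rule tendsto_minus)
  moreover have wk: "(\<integral>x. f x * deriv (p n) x \<partial>lborel) = - (\<integral>x. g x * p n x \<partial>lborel)" for n
    using w test[of n] unfolding has_weak_deriv_def by blast
  ultimately have "f a - f b = - (LINT t:{a..b}|lborel. g t)"
    by (intro LIMSEQ_unique[OF lim]) (subst wk)
  then show ?thesis by simp
qed

section \<open>Local integrability and almost-everywhere uniqueness of weak derivatives\<close>

lemma locally_integrable_continuous:
  "continuous_on UNIV f \<Longrightarrow> locally_integrable f"
  by (auto simp: locally_integrable_def intro: borel_integrable_atLeastAtMost' continuous_on_subset)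

lemma locally_integrable_measurable:
  assumes "locally_integrable g"
  shows "g \<in> borel_measurable lborel"
proof (rule borel_measurable_LIMSEQ_real)
  show "(\<lambda>x. indicator {- real n..real n} x * g x) \<in> borel_measurable lborel" for n
    using assms borel_measurable_integrable[of lborel "\<lambda>x. indicator {- real n..real n} x * g x"]
    by (simp add: locally_integrable_def set_integrable_def)
  fix x
  obtain n0 where n0: "\<bar>x\<bar> \<le> real n0" using real_arch_simple by blast
  have "indicator {- real n..real n} x * g x = g x" if "n \<ge> n0" for n
    using n0 that by (auto simp: indicator_def)
  then show "(\<lambda>n. indicator {- real n..real n} x * g x) \<longlonglongrightarrow> g x"
    by (intro tendsto_eventually) (auto simp: eventually_sequentially)
qed

lemma locally_integrable_mult_continuous:
  assumes g: "locally_integrable g" and f: "continuous_on UNIV f"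
  shows "locally_integrable (\<lambda>x. f x * g x)"
  unfolding locally_integrable_def
proof (intro allI)
  fix a b :: real
  have "bounded (f ` {a..b})"
    by (intro compact_imp_bounded compact_continuous_image continuous_on_subset[OF f]) auto
  then obtain M where M: "\<And>x. a \<le> x \<Longrightarrow> x \<le> b \<Longrightarrow> \<bar>f x\<bar> \<le> M" unfolding bounded_iff by fastforce
  have [measurable]: "f \<in> borel_measurable lborel" "g \<in> borel_measurable lborel"
    using f locally_integrable_measurable[OF g] by (auto intro: borel_measurable_continuous_onI)
  show "set_integrable lborel {a..b} (\<lambda>x. f x * g x)"
  proof (rule set_integrable_bound)
    show "set_integrable lborel {a..b} (\<lambda>x. M * g x)" using g by (simp add: locally_integrable_def)
    show "set_borel_measurable lborel {a..b} (\<lambda>x. f x * g x)" by (simp add: set_borel_measurable_def)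
    have "\<bar>f x\<bar> * \<bar>g x\<bar> \<le> \<bar>M\<bar> * \<bar>g x\<bar>" if "a \<le> x" "x \<le> b" for x
      using M[OF that] by (intro mult_right_mono) auto
    then show "AE x in lborel. x \<in> {a..b} \<longrightarrow> norm (f x * g x) \<le> norm (M * g x)" by (simp add: abs_mult)
  qed
qed

lemma set_integral_adjacent:
  assumes g: "locally_integrable g" and "a \<le> b" "b \<le> c"
  shows "(LINT t:{a..c}|lborel. g t) = (LINT t:{a..b}|lborel. g t) + (LINT t:{b..c}|lborel. g t)"
proof -
  have "AE x in lborel. x \<noteq> b" by (rule AE_lborel_singleton)
  then have "AE x in lborel. \<not> (x \<in> {a..b} \<and> x \<in> {b..c})" by eventually_elim auto
  then have "(LINT t:{a..b} \<union> {b..c}|lborel. g t) = (LINT t:{a..b}|lborel. g t) + (LINT t:{b..c}|lborel. g t)"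
    using g by (intro set_integral_Un_AE) (auto simp: locally_integrable_def)
  moreover have "{a..b} \<union> {b..c} = {a..c}" using assms by auto
  ultimately show ?thesis by simp
qed

text \<open>Cut off to [-n, n], the function is integrable, and the sets over which it integrates to
  zero form a Dynkin class. This class contains the half-lines \<open>{a<..}\<close>, an
  intersection-stable generator of the Borel sets, so the density vanishes almost
  everywhere.\<close>

lemma AE_zero_of_interval_integrals:
  assumes g: "locally_integrable g"
    and z: "\<And>a b. a \<le> b \<Longrightarrow> (LINT t:{a..b}|lborel. g t) = 0"
  shows "AE x in lborel. g x = 0"
proof -
  have "AE x in lborel. indicator {- real n..real n} x * g x = 0" for n :: nat
  proof (rule sigma_finite_measure.density_zero[OF sigma_finite_lborel])
    let ?h = "\<lambda>x. indicator {- real n..real n} x * g x"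
    show i: "integrable lborel ?h"
      using g by (simp add: locally_integrable_def set_integrable_def)
    have m[measurable]: "g \<in> borel_measurable lborel" using locally_integrable_measurable[OF g] .
    have si: "set_integrable lborel A ?h" if "A \<in> sets lborel" for A
      using integrable_mult_indicator[OF that i] by (simp add: set_integrable_def)
    fix A :: "real set" assume "A \<in> sets lborel"
    then have A: "A \<in> sigma_sets UNIV (range greaterThan)" by (simp add: borel_Ioi)
    have stable: "Int_stable (range greaterThan :: real set set)"
    proof (rule Int_stableI)
      show "A \<inter> B \<in> range greaterThan" if A: "A \<in> range greaterThan" and B: "B \<in> range greaterThan" for A B :: "real set"
      proof -
        obtain a where "A = {a<..}" using A by blast
        moreover obtain b where "B = {b<..}" using B by blast
        ultimately have "A \<inter> B = {max a b<..}" by auto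
        then show ?thesis by blast
      qed
    qed
    have top: "range greaterThan \<subseteq> Pow (UNIV :: real set)" by simp
    show "(LINT x:A|lborel. ?h x) = 0"
      using stable top A
    proof (induction rule: sigma_sets_induct_disjoint)
      case (basic A)
      then obtain a where a: "A = {a<..}" by auto
      have "AE x in lborel. x \<noteq> a" by (rule AE_lborel_singleton)
      then have "(LINT x:A|lborel. ?h x) = (LINT t:{max a (- real n)..real n}|lborel. g t)"
        unfolding set_lebesgue_integral_def a
        by (intro integral_cong_AE; (measurable)?) (elim AE_mp, auto simp: indicator_def intro!: AE_I2)
      also have "\<dots> = 0"
        using z[of "max a (- real n)" "real n"] by (cases "max a (- real n) \<le> real n") (auto simp: set_lebesgue_integral_def)
      finally show ?case .
    next
      case (compl A)
      then have A: "A \<in> sets lborel" by (simp add: borel_Ioi)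
      have "(LINT x:A \<union> (UNIV - A)|lborel. ?h x) = (LINT x:A|lborel. ?h x) + (LINT x:UNIV - A|lborel. ?h x)"
        using A by (intro set_integral_Un si) auto
      moreover have "(LINT x:UNIV|lborel. ?h x) = 0"
        using z[of "- real n" "real n"] by (simp add: set_lebesgue_integral_def)
      ultimately show ?case using compl by simp
    next
      case (union F)
      then have F: "\<And>i. F i \<in> sets lborel" by (auto simp: borel_Ioi)
      have "(LINT x:(\<Union>i. F i)|lborel. ?h x) = (\<Sum>i. (LINT x:F i|lborel. ?h x))"
        using F union.hyps(1) by (intro lebesgue_integral_countable_add si) (auto simp: disjoint_family_on_def)
      then show ?case using union by simp
    qed (auto simp: set_lebesgue_integral_def)
  qed
  then have "AE x in lborel. \<forall>n::nat. indicator {- real n..real n} x * g x = 0"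
    unfolding AE_all_countable ..
  then show ?thesis
  proof eventually_elim
    case (elim x)
    obtain n where "\<bar>x\<bar> \<le> real n" using real_arch_simple by blast
    then show ?case using elim[rule_format, of n] by (auto simp: indicator_def)
  qed
qed

text \<open>\<open>weak_deriv\<close> is an arbitrary choice; this lemma lets any known weak
  derivative replace it under an integral. Two weak derivatives have the same integral over every
  bounded interval.\<close>

lemma weak_deriv_unique_AE:
  assumes f: "continuous_on UNIV f" and g: "has_weak_deriv f g" and h: "has_weak_deriv f h"
  shows "AE x in lborel. g x = h x"
proof -
  have li: "locally_integrable g" "locally_integrable h" using g h by (auto simp: has_weak_deriv_def)
  have "AE x in lborel. g x - h x = 0"
  proof (rule AE_zero_of_interval_integrals)
    show "locally_integrable (\<lambda>x. g x - h x)"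
      using li by (auto simp: locally_integrable_def)
    fix a b :: real assume "a \<le> b"
    then show "(LINT t:{a..b}|lborel. g t - h t) = 0"
      using li weak_deriv_FTC[OF f g] weak_deriv_FTC[OF f h] by (simp add: locally_integrable_def set_integral_diff)
  qed
  then show ?thesis by eventually_elim simp
qed

text \<open>Classical integration by parts on an interval [-r, r] that contains the support of the
  test function.\<close>

lemma has_weak_deriv_C1:
  assumes f: "\<And>x. (f has_real_derivative f' x) (at x)" and f': "continuous_on UNIV f'"
  shows "has_weak_deriv f f'"
  unfolding has_weak_deriv_def
proof (intro conjI allI impI)
  have cf: "continuous_on UNIV f" using f DERIV_isCont by (auto intro!: continuous_at_imp_continuous_on)
  show "locally_integrable f" "locally_integrable f'" using cf f' locally_integrable_continuous by auto
  fix p assume t: "test_function p"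
  then have "Ck_on (Suc 0) p UNIV" by (auto simp: test_function_def smooth_on_def)
  then have p: "\<And>x. p differentiable (at x)" "continuous_on UNIV (\<lambda>x. frechet_derivative p (at x) 1)"
    by auto
  have pd: "(p has_real_derivative deriv p x) (at x)" for x
    using p(1) by (simp add: DERIV_deriv_iff_real_differentiable)
  have "frechet_derivative p (at x) 1 = deriv p x" for x
  proof -
    have "(p has_derivative (\<lambda>v. deriv p x * v)) (at x)" using pd[of x] by (simp add: has_field_derivative_def)
    then show ?thesis by (simp flip: frechet_derivative_at)
  qed
  then have cd: "continuous_on UNIV (deriv p)" using p(2) by simp
  have "bounded {x. p x \<noteq> 0}"
    using t compact_imp_bounded bounded_subset closure_subset unfolding test_function_def by metis
  then obtain R where R: "\<And>x. p x \<noteq> 0 \<Longrightarrow> \<bar>x\<bar> \<le> R" unfolding bounded_iff by auto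
  \<comment> \<open>Adding 1 makes \<open>p\<close> vanish at the endpoints themselves, which
    removes the boundary terms.\<close>
  define r where "r = \<bar>R\<bar> + 1"
  have p0: "p x = 0" if "\<bar>x\<bar> \<ge> r" for x
  proof (rule ccontr)
    assume "p x \<noteq> 0"
    then show False using R[of x] that unfolding r_def by linarith
  qed
  have d0: "deriv p x = 0" if x: "\<bar>x\<bar> > r" for x
  proof -
    have "\<forall>\<^sub>F y in nhds x. \<bar>y\<bar> > r"
      using x eventually_nhds_in_open[of "{y. r < \<bar>y\<bar>}" x]
      by (simp add: open_Collect_less continuous_on_rabs)
    then have "\<forall>\<^sub>F y in nhds x. p y = 0" by eventually_elim (simp add: p0)
    then have "(p has_real_derivative 0) (at x)"
      by (rule DERIV_cong_ev[OF refl _ refl, THEN iffD2]) (rule DERIV_const)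
    then show ?thesis by (rule DERIV_imp_deriv)
  qed
  have parts: "(\<integral>x. (f x * deriv p x) * indicator {- r..r} x \<partial>lborel)
     = f r * p r - f (- r) * p (- r) - (\<integral>x. (f' x * p x) * indicator {- r..r} x \<partial>lborel)"
    using f' cd by (intro integral_by_parts f pd) (auto simp: r_def continuous_on_eq_continuous_at)
  have restrict: "f x * deriv p x * indicator {- r..r} x = f x * deriv p x"
    "f' x * p x * indicator {- r..r} x = f' x * p x" for x
    using d0[of x] p0[of x] by (cases "\<bar>x\<bar> \<le> r"; auto simp: indicator_def)+
  have "p r = 0" "p (- r) = 0" by (simp_all add: p0)
  then show "(\<integral>x. f x * deriv p x \<partial>lborel) = - (\<integral>x. f' x * p x \<partial>lborel)"
    using parts unfolding restrict by simp
qed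

text \<open>The choice need not a priori select the square integrable derivative; almost-everywhere
  uniqueness transfers square integrability to the selected one.\<close>

lemma W12_loc_weak_deriv:
  assumes "f \<in> W12_loc"
  shows "has_weak_deriv f (weak_deriv f)" "locally_L2 (weak_deriv f)"
proof -
  obtain g where f: "continuous_on UNIV f" and g: "has_weak_deriv f g" "locally_L2 g"
    using assms by (auto simp: W12_loc_def)
  show w: "has_weak_deriv f (weak_deriv f)" unfolding weak_deriv_def by (rule someI[of "has_weak_deriv f", OF g(1)])
  have m[measurable]: "weak_deriv f \<in> borel_measurable lborel" "g \<in> borel_measurable lborel"
    using w g(1) locally_integrable_measurable unfolding has_weak_deriv_def by blast+
  have ae: "AE x in lborel. weak_deriv f x = g x" by (rule weak_deriv_unique_AE[OF f w g(1)])
  show "locally_L2 (weak_deriv f)"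
    unfolding locally_L2_def
  proof (intro conjI allI)
    fix a b :: real
    have "set_integrable lborel {a..b} (\<lambda>x. (weak_deriv f x)\<^sup>2) = set_integrable lborel {a..b} (\<lambda>x. (g x)\<^sup>2)"
      by (rule set_integrable_cong_AE) (use ae in auto)
    then show "set_integrable lborel {a..b} (\<lambda>x. (weak_deriv f x)\<^sup>2)"
      using g(2) by (simp add: locally_L2_def)
  qed (rule m)
qed

lemma weak_deriv_C1:
  assumes f: "\<And>x. (f has_real_derivative f' x) (at x)" and f': "continuous_on UNIV f'"
  shows "f \<in> W12_loc" and "AE x in lborel. weak_deriv f x = f' x"
proof -
  have cf: "continuous_on UNIV f" using f DERIV_isCont by (auto intro!: continuous_at_imp_continuous_on)
  have L2: "locally_L2 h" if "continuous_on UNIV h" for h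
    using that locally_integrable_continuous[of "\<lambda>x. (h x)\<^sup>2"]
    by (auto simp: locally_L2_def locally_integrable_def intro!: borel_measurable_continuous_onI continuous_intros)
  show W: "f \<in> W12_loc" unfolding W12_loc_def using cf f' L2 has_weak_deriv_C1[OF f f'] by blast
  show "AE x in lborel. weak_deriv f x = f' x"
    by (rule weak_deriv_unique_AE[OF cf W12_loc_weak_deriv(1)[OF W] has_weak_deriv_C1[OF f f']])
qed

text \<open>The defect \<open>D s t\<close> of the formula is additive over adjacent intervals, and
  so is the integral \<open>A s t\<close> of |g|. On short intervals the defect is at most e times
  \<open>A\<close>, by continuity of p(U); bisection extends the bound to [a, b], and e is
  arbitrary. No smooth approximation of \<open>U\<close> is involved.\<close>

lemma weak_chain_rule:
  assumes U: "continuous_on UNIV U" and w: "has_weak_deriv U g"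
    and P: "\<And>x. (P has_real_derivative p x) (at x)" and p: "continuous_on UNIV p" and "a \<le> b"
  shows "(LINT t:{a..b}|lborel. p (U t) * g t) = P (U b) - P (U a)"
proof -
  have g: "locally_integrable g" using w by (simp add: has_weak_deriv_def)
  have pU: "continuous_on UNIV (\<lambda>t. p (U t))" by (rule continuous_on_compose2[OF p U]) auto
  have pg: "locally_integrable (\<lambda>t. p (U t) * g t)"
    by (rule locally_integrable_mult_continuous[OF g pU])
  have ag: "locally_integrable (\<lambda>t. \<bar>g t\<bar>)" using g by (simp add: locally_integrable_def set_integrable_abs)
  define D where "D s t = P (U t) - P (U s) - (LINT t:{s..t}|lborel. p (U t) * g t)" for s t
  define A where "A s t = (LINT t:{s..t}|lborel. \<bar>g t\<bar>)" for s t
  have D_bound: "\<bar>D a b\<bar> \<le> e * A a b" if e: "e > 0" for e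
    using \<open>a \<le> b\<close>
  proof (induction rule: Bolzano)
    case (trans s t r)
    then have "D s r = D s t + D t r" "A s r = A s t + A t r"
      using set_integral_adjacent[OF pg, of s t r] set_integral_adjacent[OF ag, of s t r]
      by (auto simp: D_def A_def)
    then show ?case using trans by (simp add: distrib_left)
  next
    case (local x)
    have "isCont (\<lambda>t. p (U t)) x" using pU by (simp add: continuous_on_eq_continuous_at)
    then obtain d where d: "d > 0" "\<And>t. \<bar>t - x\<bar> < d \<Longrightarrow> \<bar>p (U t) - p (U x)\<bar> < e / 2"
      using e unfolding continuous_at_eps_delta dist_real_def by (metis half_gt_zero)
    have "\<bar>D s t\<bar> \<le> e * A s t" if st: "s \<le> x" "x \<le> t" "t - s < d" for s t
    proof -
      \<comment> \<open>The mean value theorem for \<open>P\<close> yields a value y between U s and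
        U t; the intermediate value theorem realizes y as U z with z in [s, t], where the continuity
        estimate around \<open>x\<close> is available.\<close>
      have "\<exists>z. s \<le> z \<and> z \<le> t \<and> P (U t) - P (U s) = (U t - U s) * p (U z)"
      proof (cases "U s = U t")
        case True
        then show ?thesis using st by (intro exI[of _ s]) auto
      next
        case False
        then have lt: "min (U s) (U t) < max (U s) (U t)" by linarith
        obtain y where y: "min (U s) (U t) < y" "y < max (U s) (U t)"
          "P (max (U s) (U t)) - P (min (U s) (U t)) = (max (U s) (U t) - min (U s) (U t)) * p y"
          using MVT2[OF lt P] by blast
        have "\<exists>z. s \<le> z \<and> z \<le> t \<and> U z = y"
        proof (cases "U s < U t")
          case True
          then show ?thesis using y st U by (intro IVT') (auto intro: continuous_on_subset)
        next
          case False
          then show ?thesis using y st U by (intro IVT2') (auto intro: continuous_on_subset)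
        qed
        then obtain z where "s \<le> z" "z \<le> t" "U z = y" by blast
        moreover have "P (U t) - P (U s) = (U t - U s) * p y"
          using y(3) False by (cases "U s < U t") (simp_all add: max_def min_def algebra_simps)
        ultimately show ?thesis by auto
      qed
      then obtain z where z: "s \<le> z" "z \<le> t" "P (U t) - P (U s) = (U t - U s) * p (U z)" by blast
      have gi: "set_integrable lborel {s..t} g" "set_integrable lborel {s..t} (\<lambda>t. p (U t) * g t)"
        using g pg by (auto simp: locally_integrable_def)
      have "D s t = (LINT r:{s..t}|lborel. p (U z) * g r) - (LINT r:{s..t}|lborel. p (U r) * g r)"
        using z(3) weak_deriv_FTC[OF U w, of s t] st by (simp add: D_def mult.commute)
      also have "\<dots> = (LINT r:{s..t}|lborel. p (U z) * g r - p (U r) * g r)"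
        using gi by (simp add: set_integral_diff)
      finally have D: "D s t = (LINT r:{s..t}|lborel. (p (U z) - p (U r)) * g r)" by (simp add: left_diff_distrib)
      have i: "set_integrable lborel {s..t} (\<lambda>r. (p (U z) - p (U r)) * g r)"
        using gi by (simp add: left_diff_distrib)
      have "\<bar>D s t\<bar> \<le> (LINT r:{s..t}|lborel. \<bar>(p (U z) - p (U r)) * g r\<bar>)"
        unfolding D using set_integral_norm_bound[OF i] by simp
      also have "\<dots> \<le> (LINT r:{s..t}|lborel. e * \<bar>g r\<bar>)"
      proof (rule set_integral_mono)
        show "set_integrable lborel {s..t} (\<lambda>r. \<bar>(p (U z) - p (U r)) * g r\<bar>)" using i by (rule set_integrable_abs)
        show "set_integrable lborel {s..t} (\<lambda>r. e * \<bar>g r\<bar>)" using gi(1) by (simp add: set_integrable_abs)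
        fix r assume "r \<in> {s..t}"
        then have "\<bar>z - x\<bar> < d" "\<bar>r - x\<bar> < d" using st z by auto
        then have "\<bar>p (U z) - p (U x)\<bar> < e / 2" "\<bar>p (U r) - p (U x)\<bar> < e / 2"
          by (blast intro: d(2))+
        then have "\<bar>p (U z) - p (U r)\<bar> \<le> e" by linarith
        then show "\<bar>(p (U z) - p (U r)) * g r\<bar> \<le> e * \<bar>g r\<bar>"
          unfolding abs_mult by (rule mult_right_mono) auto
      qed
      finally show ?thesis by (simp add: A_def)
    qed
    then show ?case using d(1) by blast
  qed
  have "\<bar>D a b\<bar> \<le> 0 + e" if "e > 0" for e
  proof -
    have A: "A a b \<ge> 0" unfolding A_def set_lebesgue_integral_def by (rule integral_nonneg_AE) auto
    \<comment> \<open>The summand 1 guards against \<open>A a b = 0\<close>.\<close>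
    have "\<bar>D a b\<bar> \<le> e / (A a b + 1) * A a b"
      using that A by (intro D_bound) simp
    also have "\<dots> \<le> e" using that A by (simp add: divide_le_eq mult_left_mono)
    finally show ?thesis by simp
  qed
  then have "\<bar>D a b\<bar> \<le> 0" by (rule field_le_epsilon)
  then show ?thesis by (simp add: D_def)
qed

section \<open>Profiles as solutions of autonomous equations\<close>

text \<open>
  For a profile \<open>f\<close> mapping the line onto the open unit interval, the derivative as a function of
  the value: \<open>f\<close> solves the autonomous equation \<open>U' = phase_speed f f' U\<close>. The extension by zero is
  continuous because \<open>f'\<close> vanishes at infinity.
\<close>

definition phase_speed :: "(real \<Rightarrow> real) \<Rightarrow> (real \<Rightarrow> real) \<Rightarrow> real \<Rightarrow> real" where
  "phase_speed f f' y = (if 0 < y \<and> y < 1 then f' (inv f y) else 0)"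

text \<open>Injectivity and a nonvanishing derivative are required instead of a sign of the
  derivative, so that the same results serve the increasing \<open>u\<close> and the decreasing
  \<open>v\<close>.\<close>

locale unit_profile =
  fixes f f' :: "real \<Rightarrow> real"
  assumes inj: "inj f" and range: "range f = {0<..<1}"
    and deriv: "\<And>x. (f has_real_derivative f' x) (at x)"
    and cont': "continuous_on UNIV f'"
    and nonzero: "\<And>x. f' x \<noteq> 0"
    and decay: "(f' \<longlongrightarrow> 0) at_bot" "(f' \<longlongrightarrow> 0) at_top"
begin

lemma profile_range: "0 < f x" "f x < 1"
  using range by (auto simp: set_eq_iff image_iff)

lemma inv_f: "inv f (f x) = x"
  by (rule inv_f_f[OF inj])

lemma f_inv: "0 < y \<Longrightarrow> y < 1 \<Longrightarrow> f (inv f y) = y"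
  using range by (intro f_inv_into_f) auto

lemma phase_speed_profile: "phase_speed f f' (f x) = f' x"
  using profile_range by (simp add: phase_speed_def inv_f)

lemma isCont_f: "isCont f x"
  using deriv DERIV_isCont by blast

lemma isCont_inv:
  assumes "0 < y" "y < 1"
  shows "isCont (inv f) y"
proof -
  have "isCont (inv f) (f (inv f y))"
    by (rule isCont_inverse_function[of 1]) (auto simp: inv_f isCont_f)
  then show ?thesis by (simp add: f_inv assms)
qed

lemma DERIV_inv:
  assumes "0 < y" "y < 1"
  shows "(inv f has_real_derivative inverse (f' (inv f y))) (at y)"
  by (rule DERIV_inverse_function[of f, where a = 0 and b = 1])
     (use assms in \<open>auto simp: nonzero f_inv isCont_inv deriv\<close>)

lemma continuous_phase_speed: "continuous_on UNIV (phase_speed f f')"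
proof -
  have "isCont (phase_speed f f') y" for y
  proof (cases "0 < y \<and> y < 1")
    case True
    have "isCont (\<lambda>y. f' (inv f y)) y"
    proof (rule isCont_o2[OF isCont_inv])
      show "isCont f' (inv f y)" using cont' by (simp add: continuous_on_eq_continuous_at)
    qed (use True in simp_all)
    moreover have "\<forall>\<^sub>F z in nhds y. f' (inv f z) = phase_speed f f' z"
      using eventually_nhds_in_open[of "{0<..<1}" y] True
      by (auto simp: phase_speed_def elim: eventually_mono)
    ultimately show ?thesis by (simp add: isCont_cong)
  next
    case False
    then have y0: "phase_speed f f' y = 0" by (auto simp: phase_speed_def)
    have "\<exists>d>0. \<forall>z. dist z y < d \<longrightarrow> dist (phase_speed f f' z) (phase_speed f f' y) < e" if e: "e > 0" for e
    proof -
      have "\<forall>\<^sub>F x in at_bot. \<bar>f' x\<bar> < e" "\<forall>\<^sub>F x in at_top. \<bar>f' x\<bar> < e"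
        using decay[THEN tendstoD, OF e] by simp_all
      \<comment> \<open>The parameters in [a, b] have a compact image that misses \<open>y\<close>.
        Values close enough to \<open>y\<close> thus come from parameters outside [a, b], where
        \<open>f'\<close> is small.\<close>
      then obtain a b where ab: "\<And>x. x \<le> a \<Longrightarrow> \<bar>f' x\<bar> < e" "\<And>x. x \<ge> b \<Longrightarrow> \<bar>f' x\<bar> < e"
        unfolding eventually_at_bot_linorder eventually_at_top_linorder by blast
      have "closed (f ` {a..b})"
        by (intro compact_imp_closed compact_continuous_image continuous_at_imp_continuous_on ballI isCont_f) simp
      then have "open (- (f ` {a..b}))" by (rule open_Compl)
      moreover have "y \<in> - (f ` {a..b})" using False profile_range by auto
      ultimately obtain d where d: "d > 0" "ball y d \<subseteq> - (f ` {a..b})"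
        by (rule openE)
      have "dist (phase_speed f f' z) (phase_speed f f' y) < e" if z: "dist z y < d" for z
      proof (cases "0 < z \<and> z < 1")
        case True
        then have fz: "f (inv f z) = z" by (simp add: f_inv)
        have "z \<notin> f ` {a..b}" using d(2) z by (auto simp: dist_commute)
        then have "f (inv f z) \<notin> f ` {a..b}" unfolding fz .
        then have "inv f z \<notin> {a..b}" by (blast intro: imageI)
        then have "inv f z \<le> a \<or> b \<le> inv f z" by auto
        then have "\<bar>f' (inv f z)\<bar> < e" using ab by blast
        then show ?thesis using True y0 by (simp add: phase_speed_def)
      next
        case False
        then have "phase_speed f f' z = 0" by (auto simp: phase_speed_def)
        then show ?thesis using e y0 by simp
      qed
      then show ?thesis using d(1) by blast
    qed
    then show ?thesis unfolding continuous_at_eps_delta by blast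
  qed
  then show ?thesis by (simp add: continuous_on_eq_continuous_at)
qed

text \<open>The set \<open>T\<close> of agreement with a translate of \<open>f\<close> is clopen.
  Openness: on \<open>T\<close> the value of \<open>U\<close> lies in the open unit interval, and
  near such a point \<open>inv f (U y) - y\<close> has derivative zero. Points where the speed is
  extended by zero are never reached, so no Lipschitz bound is used.\<close>

lemma phase_ode_translate:
  assumes U: "\<And>z. (U has_real_derivative phase_speed f f' (U z)) (at z)"
    and z0: "0 < U z0" "U z0 < 1"
  obtains s where "\<And>z. U z = f (z + s)"
proof -
  have cU: "continuous_on UNIV U"
    using DERIV_isCont[OF U] by (simp add: continuous_at_imp_continuous_on)
  define s where "s = inv f (U z0) - z0"
  define T where "T = {z. U z = f (z + s)}"
  have "closed T" unfolding T_def
  proof (rule closed_Collect_eq[OF cU])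
    show "continuous_on UNIV (\<lambda>z. f (z + s))"
      by (intro continuous_at_imp_continuous_on ballI isCont_o2[OF _ isCont_f] continuous_intros)
  qed
  moreover have "open T"
    unfolding open_contains_ball
  proof
    fix z assume "z \<in> T"
    then have z: "U z = f (z + s)" by (simp add: T_def)
    have "open (U -` {0<..<1})" by (intro open_vimage cU) simp
    moreover have "z \<in> U -` {0<..<1}" using profile_range by (simp add: z)
    ultimately obtain d where d: "d > 0" "ball z d \<subseteq> U -` {0<..<1}" unfolding open_contains_ball by blast
    have "((\<lambda>y. inv f (U y) - y) has_real_derivative 0) (at y within ball z d)" if "y \<in> ball z d" for y
    proof -
      have y: "0 < U y" "U y < 1" using d(2) that by auto
      have "((\<lambda>y. inv f (U y) - y) has_real_derivative
          inverse (f' (inv f (U y))) * phase_speed f f' (U y) - 1) (at y)"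
        by (rule DERIV_diff[OF DERIV_chain2[where g = U, OF DERIV_inv[OF y] U] DERIV_ident])
      then have "((\<lambda>y. inv f (U y) - y) has_real_derivative 0) (at y)"
        using y nonzero by (simp add: phase_speed_def)
      then show ?thesis by (rule has_field_derivative_at_within)
    qed
    then have "\<exists>c. \<forall>y\<in>ball z d. inv f (U y) - y = c"
      by (intro has_field_derivative_zero_constant) auto
    then obtain c where c: "\<And>y. y \<in> ball z d \<Longrightarrow> inv f (U y) - y = c" by blast
    have "c = s" using c[of z] d(1) by (simp add: z inv_f)
    have "U y = f (y + s)" if "y \<in> ball z d" for y
    proof -
      have "inv f (U y) = y + s" using c[OF that] \<open>c = s\<close> by simp
      moreover have "f (inv f (U y)) = U y" using d(2) that by (intro f_inv) auto
      ultimately show ?thesis by simp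
    qed
    then show "\<exists>e>0. ball z e \<subseteq> T" using d(1) by (auto simp: T_def)
  qed
  moreover have "z0 \<in> T" by (simp add: T_def s_def f_inv z0)
  ultimately have "T = UNIV" using clopen[of T] by blast
  then show ?thesis using that[of s] by (auto simp: T_def)
qed

text \<open>The right-hand side is continuous in z, so it has a classical antiderivative;
  \<open>U\<close> has the same increments and hence solves the equation classically.\<close>

lemma weak_phase_ode_translate:
  assumes U: "continuous_on UNIV U" and w: "has_weak_deriv U g"
    and ae: "AE z in lborel. g z = phase_speed f f' (U z)"
    and z0: "0 < U z0" "U z0 < 1"
  obtains s where "\<And>z. U z = f (z + s)"
proof -
  have pU: "continuous_on UNIV (\<lambda>z. phase_speed f f' (U z))"
    by (rule continuous_on_compose2[OF continuous_phase_speed U]) auto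
  obtain Z where Z: "\<And>x. (Z has_real_derivative phase_speed f f' (U x)) (at x)"
    using antiderivative_exists[OF pU] by blast
  have g: "g \<in> borel_measurable lborel"
    using w locally_integrable_measurable unfolding has_weak_deriv_def by blast
  have pm: "(\<lambda>z. phase_speed f f' (U z)) \<in> borel_measurable lborel"
    using borel_measurable_continuous_onI[OF pU] by simp
  have incr: "U b - U a = Z b - Z a" if "a \<le> b" for a b
  proof -
    have "U b - U a = (LINT t:{a..b}|lborel. g t)" using weak_deriv_FTC[OF U w that] by simp
    also have "\<dots> = (LINT t:{a..b}|lborel. phase_speed f f' (U t))"
    proof (rule set_lebesgue_integral_cong_AE[OF _ g pm])
      show "AE t \<in> {a..b} in lborel. g t = phase_speed f f' (U t)" using ae by eventually_elim simp
    qed simp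
    also have "\<dots> = Z b - Z a"
      by (rule weak_deriv_FTC[OF _ has_weak_deriv_C1[OF Z pU] that])
         (use DERIV_isCont[OF Z] in \<open>simp add: continuous_at_imp_continuous_on\<close>)
    finally show ?thesis .
  qed
  define c where "c = U 0 - Z 0"
  have "U z = Z z + c" for z
    using incr[of 0 z] incr[of z 0] unfolding c_def by linarith
  then have UZ: "U = (\<lambda>z. Z z + c)" by blast
  have "((\<lambda>z. Z z + c) has_real_derivative phase_speed f f' (U z) + 0) (at z)" for z
    by (intro DERIV_add Z DERIV_const)
  then have "(U has_real_derivative phase_speed f f' (U z)) (at z)" for z
    unfolding UZ[symmetric] by simp
  then show ?thesis using phase_ode_translate[of U z0, OF _ z0] that by blast
qed

end

section \<open>Calibration of monotone connections\<close>

lemma strict_mono_inj_range: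
  fixes f :: "real \<Rightarrow> real"
  assumes mono: "\<And>x y. x < y \<Longrightarrow> f x < f y" and cont: "continuous_on UNIV f"
    and lim: "(f \<longlongrightarrow> a) at_bot" "(f \<longlongrightarrow> b) at_top"
  shows "inj f" "range f = {a<..<b}"
proof -
  show "inj f" by (metis injI mono less_irrefl linorder_neqE)
  have le: "f x \<le> f y" if "x \<le> y" for x y using mono[of x y] that by (cases "x = y") auto
  have lo: "a < f x" for x
  proof -
    have "\<forall>\<^sub>F t in at_bot. f t \<le> f (x - 1)"
      using eventually_le_at_bot[of "x - 1"] by eventually_elim (rule le)
    then have "a \<le> f (x - 1)" by (rule tendsto_upperbound[OF lim(1)]) simp
    then show ?thesis using mono[of "x - 1" x] by simp
  qed
  have hi: "f x < b" for x
  proof -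
    have "\<forall>\<^sub>F t in at_top. f (x + 1) \<le> f t"
      using eventually_ge_at_top[of "x + 1"] by eventually_elim (rule le)
    then have "f (x + 1) \<le> b" by (rule tendsto_lowerbound[OF lim(2)]) simp
    then show ?thesis using mono[of x "x + 1"] by simp
  qed
  have "y \<in> range f" if y: "a < y" "y < b" for y
  proof -
    obtain s where s: "f s < y"
      using order_tendstoD(2)[OF lim(1) y(1)] unfolding eventually_at_bot_linorder by blast
    obtain t where t: "y < f t"
      using order_tendstoD(1)[OF lim(2) y(2)] unfolding eventually_at_top_linorder by blast
    have "s \<le> t" using s t le[of t s] by linarith
    then obtain x where "f x = y"
      using IVT'[of f s y t] s t continuous_on_subset[OF cont] by (metis less_imp_le subset_UNIV)
    then show ?thesis by blast
  qed
  then show "range f = {a<..<b}" using lo hi by (auto simp: set_eq_iff)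
qed

section \<open>The potential, the conserved Hamiltonian and the sign of the calibration gap\<close>

definition potential :: "real \<Rightarrow> real \<Rightarrow> real \<Rightarrow> real" where
  "potential Lam x y = (1 - x\<^sup>2 - y\<^sup>2)\<^sup>2 / 4 + (Lam - 1) / 2 * x\<^sup>2 * y\<^sup>2"

lemma potential_commute: "potential Lam x y = potential Lam y x"
  by (simp add: potential_def algebra_simps)

text \<open>Beyond x = 1 the quantity x^2 + y^2 - 1 is nonnegative and grows with x, and the
  coupling term does not decrease. This is the estimate behind clipping competitors to the unit
  square.\<close>

lemma potential_min_one:
  assumes "Lam \<ge> 1" "x \<ge> 0"
  shows "potential Lam (min x 1) y \<le> potential Lam x y"
proof (cases "x \<le> 1")
  case False
  have "potential Lam x y - potential Lam 1 y =
      (x\<^sup>2 - 1) * ((x\<^sup>2 - 1 + 2 * y\<^sup>2) / 4 + (Lam - 1) / 2 * y\<^sup>2)"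
    by (simp add: potential_def power2_eq_square field_simps)
  moreover have "x\<^sup>2 \<ge> 1" using False by (simp add: one_le_power)
  then have "0 \<le> (x\<^sup>2 - 1) * ((x\<^sup>2 - 1 + 2 * y\<^sup>2) / 4 + (Lam - 1) / 2 * y\<^sup>2)"
    using assms by (intro mult_nonneg_nonneg add_nonneg_nonneg divide_nonneg_nonneg) auto
  ultimately have "0 \<le> potential Lam x y - potential Lam 1 y" by simp
  then show ?thesis using False by (simp add: min_def)
qed (simp add: min_def)

lemma heteroclinic_connection_alt:
  assumes u: "\<And>x. (u has_real_derivative u' x) (at x)" and v: "\<And>x. (v has_real_derivative v' x) (at x)"
    and u2: "\<And>x. (u' has_real_derivative u'' x) (at x)" and v2: "\<And>x. (v' has_real_derivative v'' x) (at x)"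
    and "\<And>x. lam\<^sup>2 * u'' x = u x ^ 3 - u x + Lam * (v x)\<^sup>2 * u x"
    and "\<And>x. v'' x = v x ^ 3 - v x + Lam * (u x)\<^sup>2 * v x" and "connecting u v"
  shows "heteroclinic_connection lam Lam u v"
proof -
  have "deriv u = u'" "deriv v = v'" using u v DERIV_imp_deriv by blast+
  moreover have "deriv u' = u''" "deriv v' = v''" using u2 v2 DERIV_imp_deriv by blast+
  moreover have "u differentiable (at z)" "v differentiable (at z)" "u' differentiable (at z)"
    "v' differentiable (at z)" for z
    using u v u2 v2 real_differentiable_def by blast+
  ultimately show ?thesis unfolding heteroclinic_connection_def using assms(5-7) by simp
qed

text \<open>The decay of the derivatives at both ends makes the extended phase speeds continuous and
  fixes the value of the Hamiltonian.\<close>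

locale monotone_connection =
  fixes lam Lam :: real and u v u' v' :: "real \<Rightarrow> real"
  assumes lam: "lam > 0" and Lam: "Lam \<ge> 1"
    and u: "\<And>x. (u has_real_derivative u' x) (at x)"
    and v: "\<And>x. (v has_real_derivative v' x) (at x)"
    and u2: "\<And>x. (u' has_real_derivative (u x ^ 3 - u x + Lam * (v x)\<^sup>2 * u x) / lam\<^sup>2) (at x)"
    and v2: "\<And>x. (v' has_real_derivative v x ^ 3 - v x + Lam * (u x)\<^sup>2 * v x) (at x)"
    and u'_pos: "\<And>x. u' x > 0" and v'_neg: "\<And>x. v' x < 0"
    and connecting: "connecting u v"
    and decay: "(u' \<longlongrightarrow> 0) at_bot" "(u' \<longlongrightarrow> 0) at_top" "(v' \<longlongrightarrow> 0) at_bot" "(v' \<longlongrightarrow> 0) at_top"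
begin

lemma u_less: "x < y \<Longrightarrow> u x < u y"
  by (rule DERIV_pos_imp_increasing) (use u u'_pos in blast)+

lemma v_less: "x < y \<Longrightarrow> v y < v x"
  by (rule DERIV_neg_imp_decreasing) (use v v'_neg in blast)+

lemma cont_uv: "continuous_on UNIV u" "continuous_on UNIV v" "continuous_on UNIV u'" "continuous_on UNIV v'"
  using DERIV_isCont[OF u] DERIV_isCont[OF v] DERIV_isCont[OF u2] DERIV_isCont[OF v2]
  by (simp_all add: continuous_at_imp_continuous_on)

sublocale u: unit_profile u u'
proof
  show "inj u" "range u = {0<..<1}"
    using strict_mono_inj_range[of u 0 1] u_less cont_uv connecting by (auto simp: connecting_def)
  show "u' x \<noteq> 0" for x using u'_pos[of x] by simp
qed (use u cont_uv decay in auto)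

sublocale v: unit_profile v v'
proof
  \<comment> \<open>\<open>v\<close> decreases, so the result on increasing functions is applied to
    its reflection.\<close>
  have 1: "((\<lambda>x. v (- x)) \<longlongrightarrow> 0) at_bot" "((\<lambda>x. v (- x)) \<longlongrightarrow> 1) at_top"
    using connecting filterlim_compose[OF _ filterlim_uminus_at_top_at_bot]
      filterlim_compose[OF _ filterlim_uminus_at_bot_at_top] by (auto simp: connecting_def)
  have 2: "continuous_on UNIV (\<lambda>x. v (- x))"
    by (rule continuous_on_compose2[OF cont_uv(2)]) (auto intro: continuous_intros)
  have 3: "inj (\<lambda>x. v (- x))" "range (\<lambda>x. v (- x)) = {0<..<1}"
    by (rule strict_mono_inj_range[OF _ 2 1]; simp add: v_less)+
  show "inj v" using v_less by (metis injI less_irrefl linorder_neqE)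
  have "v ` range uminus = range (\<lambda>x. v (- x))" by (rule image_image)
  moreover have "range uminus = (UNIV :: real set)" by simp
  ultimately show "range v = {0<..<1}" using 3(2) by (simp only:)
  show "v' x \<noteq> 0" for x using v'_neg[of x] by simp
qed (use v cont_uv decay in auto)

abbreviation p :: "real \<Rightarrow> real" where "p \<equiv> phase_speed u u'"
abbreviation q :: "real \<Rightarrow> real" where "q \<equiv> phase_speed v v'"

definition gap :: "real \<Rightarrow> real \<Rightarrow> real" where
  "gap x y = potential Lam x y - lam\<^sup>2 * (p x)\<^sup>2 / 2 - (q y)\<^sup>2 / 2"

lemma hamiltonian: "potential Lam (u x) (v x) = lam\<^sup>2 * (u' x)\<^sup>2 / 2 + (v' x)\<^sup>2 / 2"
proof -
  define H where "H x = potential Lam (u x) (v x) - lam\<^sup>2 * (u' x)\<^sup>2 / 2 - (v' x)\<^sup>2 / 2" for x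
  have "(H has_real_derivative 0) (at x)" for x
    unfolding H_def[abs_def] potential_def
    by (auto intro!: derivative_eq_intros u v u2 v2)
       (use lam in \<open>simp add: field_simps power2_eq_square power3_eq_cube\<close>,
        simp add: field_simps power2_eq_square power3_eq_cube)
  then have "H x = H y" for x y by (blast intro: DERIV_isconst_all)
  then have "H = (\<lambda>_. H x)" by blast
  \<comment> \<open>The constant is read off at the end state (1, 0), a zero of the
    potential.\<close>
  moreover have "(H \<longlongrightarrow> potential Lam 1 0 - lam\<^sup>2 * 0\<^sup>2 / 2 - 0\<^sup>2 / 2) at_top"
    unfolding H_def[abs_def] potential_def using connecting decay unfolding connecting_def
    by (intro tendsto_intros) auto
  ultimately have "H x = potential Lam 1 0 - lam\<^sup>2 * 0\<^sup>2 / 2 - 0\<^sup>2 / 2"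
    by (metis tendsto_const_iff trivial_limit_at_top_linorder)
  then show ?thesis by (simp add: H_def potential_def)
qed

lemma gap_diagonal: "gap (u s) (v s) = 0"
  by (simp add: gap_def u.phase_speed_profile v.phase_speed_profile hamiltonian)

text \<open>Along the orbit lam^2 u''(s) is the x-derivative of the potential at (u(s), v(s)),
  whereas differentiating the gap in s evaluates that derivative at (u(s), v(t)). Only the coupling
  term survives the subtraction. The gap is zero at s = t, so the mean value theorem gives its sign
  on either side.\<close>

lemma gap_off_diagonal:
  assumes "s \<noteq> t"
  shows "gap (u s) (v t) > 0"
proof -
  let ?F = "\<lambda>s. potential Lam (u s) (v t) - lam\<^sup>2 * (u' s)\<^sup>2 / 2 - (v' t)\<^sup>2 / 2"
  let ?D = "\<lambda>s. u' s * Lam * u s * ((v t)\<^sup>2 - (v s)\<^sup>2)"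
  have F: "gap (u s) (v t) = ?F s" for s
    by (simp add: gap_def u.phase_speed_profile v.phase_speed_profile)
  have D: "(?F has_real_derivative ?D s) (at s)" for s
    unfolding potential_def
    by (auto intro!: derivative_eq_intros u u2)
       (use lam in \<open>simp add: field_simps power2_eq_square power3_eq_cube\<close>,
        simp add: field_simps power2_eq_square power3_eq_cube)
  have F0: "?F t = 0" using hamiltonian[of t] by simp
  have pos: "u' z * Lam * u z > 0" for z
    using u'_pos[of z] Lam u.profile_range(1)[of z] by (intro mult_pos_pos) auto
  have sq: "(v y)\<^sup>2 < (v x)\<^sup>2" if "x < y" for x y
    using v_less[OF that] v.profile_range(1)[of y] by (intro power_strict_mono) auto
  show ?thesis
  proof (cases "t < s")
    case True
    obtain z where z: "t < z" "z < s" "?F s - ?F t = (s - t) * ?D z"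
      using MVT2[OF True, of ?F ?D] D by blast
    have "0 < (s - t) * ?D z" using z(1) True pos[of z] sq[OF z(1)] by simp
    then have "0 < ?F s" using z(3) F0 by linarith
    then show ?thesis using F by simp
  next
    case False
    then have "s < t" using assms by simp
    obtain z where z: "s < z" "z < t" "?F t - ?F s = (t - s) * ?D z"
      using MVT2[OF \<open>s < t\<close>, of ?F ?D] D by blast
    have "(t - s) * ?D z < 0"
      using z(2) \<open>s < t\<close> pos[of z] sq[OF z(2)] by (intro mult_pos_neg) auto
    then have "0 < ?F s" using z(3) F0 by linarith
    then show ?thesis using F by simp
  qed
qed

lemma continuous_gap: "continuous_on UNIV (\<lambda>z. gap (fst z) (snd z))"
  unfolding gap_def potential_def
  by (intro continuous_intros continuous_on_compose2[OF u.continuous_phase_speed]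
      continuous_on_compose2[OF v.continuous_phase_speed]) auto

text \<open>
  Values outside the unit square reduce to the square by symmetry and clipping, and the boundary of
  the square to its interior by continuity.
\<close>

lemma gap_nonneg: "0 \<le> gap x y"
proof -
  have open_square: "0 \<le> gap x y" if "0 < x" "x < 1" "0 < y" "y < 1" for x y
  proof -
    have "0 \<le> gap (u s) (v t)" for s t
      using gap_off_diagonal[of s t] gap_diagonal[of s] by (cases "s = t") auto
    then have "0 \<le> gap (u (inv u x)) (v (inv v y))" .
    then show ?thesis using that by (simp add: u.f_inv v.f_inv)
  qed
  have "closed {z. 0 \<le> gap (fst z) (snd z)}"
    by (rule closed_Collect_le[OF continuous_on_const continuous_gap])
  then have "closure ({0<..<1} \<times> {0<..<1}) \<subseteq> {z. 0 \<le> gap (fst z) (snd z)}"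
  proof (rule closure_minimal[rotated])
    show "{0<..<1} \<times> {0<..<1} \<subseteq> {z. 0 \<le> gap (fst z) (snd z)}" using open_square by force
  qed
  then have square: "0 \<le> gap x y" if "0 \<le> x" "x \<le> 1" "0 \<le> y" "y \<le> 1" for x y
  proof -
    have "(x, y) \<in> closure ({0<..<1} \<times> {0<..<1})" using that by (simp add: closure_Times)
    then show ?thesis using \<open>closure _ \<subseteq> _\<close> by auto
  qed
  \<comment> \<open>The speeds vanish outside the open unit interval, so clipping cannot decrease
    their squares; it also cannot increase the potential. The gap at the clipped point is thus a
    lower bound.\<close>
  have clip_p: "(p x)\<^sup>2 \<le> (p (min \<bar>x\<bar> 1))\<^sup>2" and clip_q: "(q x)\<^sup>2 \<le> (q (min \<bar>x\<bar> 1))\<^sup>2" for x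
    by (auto simp: phase_speed_def min_def)
  have "potential Lam (min \<bar>x\<bar> 1) (min \<bar>y\<bar> 1) \<le> potential Lam \<bar>x\<bar> (min \<bar>y\<bar> 1)"
    by (rule potential_min_one[OF Lam]) simp
  also have "\<dots> \<le> potential Lam \<bar>x\<bar> \<bar>y\<bar>"
    unfolding potential_commute[of Lam "\<bar>x\<bar>"] by (rule potential_min_one[OF Lam]) simp
  also have "\<dots> = potential Lam x y" by (simp add: potential_def)
  finally have "potential Lam (min \<bar>x\<bar> 1) (min \<bar>y\<bar> 1) \<le> potential Lam x y" .
  moreover have "0 \<le> gap (min \<bar>x\<bar> 1) (min \<bar>y\<bar> 1)" by (rule square) auto
  moreover have "lam\<^sup>2 * (p x)\<^sup>2 \<le> lam\<^sup>2 * (p (min \<bar>x\<bar> 1))\<^sup>2"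
    by (rule mult_left_mono[OF clip_p]) simp
  ultimately show ?thesis using clip_q[of y] unfolding gap_def by linarith
qed

end

section \<open>The energy identity and the characterization of minimizers\<close>

text \<open>The chain rule lives on bounded intervals, where all integrals are finite; monotone
  convergence carries the resulting identity to the line, including the case of infinite
  energy.\<close>

lemma nn_integral_tendsto_expanding:
  fixes f :: "real \<Rightarrow> real"
  assumes f: "f \<in> borel_measurable lborel" "\<And>x. 0 \<le> f x"
    and int: "\<And>n. set_integrable lborel {- real n..real n} f"
  shows "(\<lambda>n. ennreal (LINT x:{- real n..real n}|lborel. f x)) \<longlonglongrightarrow> (\<integral>\<^sup>+x. ennreal (f x) \<partial>lborel)"
proof -
  let ?g = "\<lambda>n x. ennreal (indicator {- real n..real n} x * f x)"
  have "ennreal (LINT x:{- real n..real n}|lborel. f x) = (\<integral>\<^sup>+x. ?g n x \<partial>lborel)" for n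
    using int[of n] f(2) unfolding set_lebesgue_integral_def set_integrable_def
    by (subst nn_integral_eq_integral) (auto simp: indicator_def)
  moreover have "(\<lambda>n. \<integral>\<^sup>+x. ?g n x \<partial>lborel) \<longlonglongrightarrow> (\<integral>\<^sup>+x. ennreal (f x) \<partial>lborel)"
  proof (rule nn_integral_LIMSEQ)
    show "incseq ?g"
    proof (rule incseq_SucI, rule le_funI)
      fix n x
      have "indicator {- real n..real n} x \<le> (indicator {- real (Suc n)..real (Suc n)} x :: real)"
        by (simp add: indicator_def)
      then show "?g n x \<le> ?g (Suc n) x" using f(2)[of x] by (intro ennreal_leI mult_right_mono)
    qed
    show "?g n \<in> borel_measurable lborel" for n using f(1) by measurable
    show "(\<lambda>n. ?g n x) \<longlonglongrightarrow> ennreal (f x)" for x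
    proof (rule tendsto_eventually)
      obtain n0 where n0: "\<bar>x\<bar> \<le> real n0" using real_arch_simple by blast
      have "?g n x = ennreal (f x)" if "n \<ge> n0" for n
        using n0 that by (simp add: indicator_def abs_le_iff)
      then show "\<forall>\<^sub>F n in sequentially. ?g n x = ennreal (f x)" by (auto simp: eventually_sequentially)
    qed
  qed
  ultimately show ?thesis by simp
qed

lemma AE_lborel_ex:
  assumes "AE x in lborel. P x"
  shows "\<exists>x::real. P x"
proof -
  have "ae_filter (lborel :: real measure) \<noteq> bot" by (simp add: ae_filter_eq_bot_iff)
  then show ?thesis using assms eventually_happens' by blast
qed

context monotone_connection
begin

definition excess :: "(real \<Rightarrow> real) \<Rightarrow> (real \<Rightarrow> real) \<Rightarrow> real \<Rightarrow> real" where
  "excess U V z = lam\<^sup>2 * (weak_deriv U z - p (U z))\<^sup>2 / 2 + (weak_deriv V z - q (V z))\<^sup>2 / 2 + gap (U z) (V z)"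

lemma excess_nonneg: "0 \<le> excess U V z"
  unfolding excess_def using gap_nonneg by (intro add_nonneg_nonneg) auto

text \<open>On [-n, n] the energy density differs from the excess by the cross terms, whose integral
  is the boundary contribution \<open>c n\<close>. Continuity of the antiderivatives and the
  prescribed end states give the limit \<open>C\<close>, the same for every competitor.\<close>

lemma energy_eq_excess:
  obtains C where "C > 0"
    "\<And>U V. (U, V) \<in> admissible \<Longrightarrow>
      excess U V \<in> borel_measurable lborel \<and>
      energy lam Lam (U, V) = ennreal C + (\<integral>\<^sup>+z. ennreal (excess U V z) \<partial>lborel)"
proof -
  obtain P where P: "\<And>x. (P has_real_derivative p x) (at x)"
    using antiderivative_exists[OF u.continuous_phase_speed] by blast
  obtain Q where Q: "\<And>x. (Q has_real_derivative q x) (at x)"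
    using antiderivative_exists[OF v.continuous_phase_speed] by blast
  define C where "C = lam\<^sup>2 * (P 1 - P 0) + (Q 0 - Q 1)"
  have "C > 0"
  proof -
    \<comment> \<open>The mean value theorem evaluates the speeds at interior values, where they
      inherit the signs of \<open>u'\<close> and \<open>v'\<close>.\<close>
    obtain z where z: "0 < z" "z < 1" "P 1 - P 0 = (1 - 0) * p z"
      using MVT2[of 0 1 P p] P by auto
    have "P 1 - P 0 > 0" using z u'_pos by (simp add: phase_speed_def)
    moreover obtain w where w: "0 < w" "w < 1" "Q 1 - Q 0 = (1 - 0) * q w"
      using MVT2[of 0 1 Q q] Q by auto
    have "Q 1 - Q 0 < 0" using w v'_neg by (simp add: phase_speed_def)
    ultimately show ?thesis using lam by (simp add: C_def add_pos_pos)
  qed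
  moreover have "excess U V \<in> borel_measurable lborel \<and>
      energy lam Lam (U, V) = ennreal C + (\<integral>\<^sup>+z. ennreal (excess U V z) \<partial>lborel)"
    if adm: "(U, V) \<in> admissible" for U V
  proof -
    have W: "U \<in> W12_loc" "V \<in> W12_loc" and con: "connecting U V" using adm by (auto simp: admissible_def)
    then have cU: "continuous_on UNIV U" and cV: "continuous_on UNIV V" by (auto simp: W12_loc_def)
    define g h where "g = weak_deriv U" and "h = weak_deriv V"
    have wg: "has_weak_deriv U g" "locally_L2 g" and wh: "has_weak_deriv V h" "locally_L2 h"
      using W12_loc_weak_deriv W by (simp_all add: g_def h_def)
    have lg: "locally_integrable g" "locally_integrable h"
      using wg wh by (simp_all add: has_weak_deriv_def)
    have [measurable]: "g \<in> borel_measurable lborel" "h \<in> borel_measurable lborel"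
      using lg by (simp_all only: locally_integrable_measurable)
    have cpU: "continuous_on UNIV (\<lambda>z. p (U z))" and cqV: "continuous_on UNIV (\<lambda>z. q (V z))"
      by (auto intro: continuous_on_compose2[OF u.continuous_phase_speed cU]
          continuous_on_compose2[OF v.continuous_phase_speed cV])
    have cW: "continuous_on UNIV (\<lambda>z. potential Lam (U z) (V z))"
      unfolding potential_def by (intro continuous_intros cU cV) auto
    have [measurable]: "(\<lambda>z. p (U z)) \<in> borel_measurable lborel" "(\<lambda>z. q (V z)) \<in> borel_measurable lborel"
      "(\<lambda>z. potential Lam (U z) (V z)) \<in> borel_measurable lborel"
      using cpU cqV cW by (simp_all add: borel_measurable_continuous_onI)
    define e where "e z = lam\<^sup>2 * (g z)\<^sup>2 / 2 + (h z)\<^sup>2 / 2 + potential Lam (U z) (V z)" for z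
    define r where "r = excess U V"
    \<comment> \<open>The squares of the speeds produced by the completed squares cancel those
      subtracted in \<open>gap\<close>.\<close>
    have r: "r z = e z - (lam\<^sup>2 * (p (U z) * g z) + q (V z) * h z)" for z
      unfolding r_def excess_def e_def gap_def g_def h_def by (simp add: power2_eq_square field_simps)
    have r_nonneg: "0 \<le> r z" for z by (simp add: r_def excess_nonneg)
    have e_nonneg: "0 \<le> e z" for z
      using Lam by (auto simp: e_def potential_def)
    have em[measurable]: "e \<in> borel_measurable lborel" unfolding e_def by measurable
    have rm: "r \<in> borel_measurable lborel" unfolding r by measurable
    have pi: "set_integrable lborel {- real n..real n} (\<lambda>z. p (U z) * g z)"
      and qi: "set_integrable lborel {- real n..real n} (\<lambda>z. q (V z) * h z)" for n
      using locally_integrable_mult_continuous[OF lg(1) cpU] locally_integrable_mult_continuous[OF lg(2) cqV]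
      by (simp_all add: locally_integrable_def)
    have ei: "set_integrable lborel {- real n..real n} e" for n
    proof -
      have "set_integrable lborel {- real n..real n} (\<lambda>z. potential Lam (U z) (V z))"
        using locally_integrable_continuous[OF cW] by (simp add: locally_integrable_def)
      moreover have "set_integrable lborel {- real n..real n} (\<lambda>z. lam\<^sup>2 * (g z)\<^sup>2 / 2)"
        "set_integrable lborel {- real n..real n} (\<lambda>z. (h z)\<^sup>2 / 2)"
        using wg(2) wh(2) by (simp_all add: locally_L2_def)
      ultimately show ?thesis unfolding e_def by (intro set_integral_add(1))
    qed
    have li: "set_integrable lborel {- real n..real n} (\<lambda>z. lam\<^sup>2 * (p (U z) * g z) + q (V z) * h z)" for n
      by (intro set_integral_add(1) set_integrable_mult_right pi qi)
    have ri: "set_integrable lborel {- real n..real n} r" for n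
      unfolding r by (intro set_integral_diff(1) ei li)
    define c where "c n = lam\<^sup>2 * (P (U (real n)) - P (U (- real n))) + (Q (V (real n)) - Q (V (- real n)))" for n
    have ec: "(LINT z:{- real n..real n}|lborel. e z) = c n + (LINT z:{- real n..real n}|lborel. r z)" for n
    proof -
      have "(LINT z:{- real n..real n}|lborel. r z) = (LINT z:{- real n..real n}|lborel. e z)
          - (LINT z:{- real n..real n}|lborel. lam\<^sup>2 * (p (U z) * g z) + q (V z) * h z)"
        unfolding r by (rule set_integral_diff(2)[OF ei li])
      also have "(LINT z:{- real n..real n}|lborel. lam\<^sup>2 * (p (U z) * g z) + q (V z) * h z) =
          lam\<^sup>2 * (LINT z:{- real n..real n}|lborel. p (U z) * g z)
          + (LINT z:{- real n..real n}|lborel. q (V z) * h z)"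
        by (subst set_integral_add(2)[OF set_integrable_mult_right[OF pi] qi]) simp
      also have "\<dots> = c n"
        unfolding c_def weak_chain_rule[OF cU wg(1) P u.continuous_phase_speed, of "- real n" "real n", simplified]
          weak_chain_rule[OF cV wh(1) Q v.continuous_phase_speed, of "- real n" "real n", simplified] ..
      finally show ?thesis by simp
    qed
    have "c \<longlonglongrightarrow> lam\<^sup>2 * (P 1 - P 0) + (Q 0 - Q 1)"
    proof -
      have t: "filterlim real at_top sequentially" by (rule filterlim_real_sequentially)
      have b: "filterlim (\<lambda>n. - real n) at_bot sequentially"
        using filterlim_compose[OF filterlim_uminus_at_bot_at_top t] .
      note lims = con[unfolded connecting_def]
      show ?thesis unfolding c_def[abs_def]
        by (intro tendsto_intros isCont_tendsto_compose[OF DERIV_isCont[OF P]] isCont_tendsto_compose[OF DERIV_isCont[OF Q]]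
            filterlim_compose[OF _ t] filterlim_compose[OF _ b]) (use lims in auto)
    qed
    then have c: "c \<longlonglongrightarrow> C" by (simp add: C_def)
    \<comment> \<open>\<open>ennreal\<close> sends negative numbers to 0 and is additive only on
      nonnegative ones, so \<open>c n\<close> must be eventually positive; this is where C > 0
      enters.\<close>
    have "\<forall>\<^sub>F n in sequentially. c n > 0" using order_tendstoD(1)[OF c \<open>C > 0\<close>] .
    then have ev: "\<forall>\<^sub>F n in sequentially. ennreal (c n) + ennreal (LINT z:{- real n..real n}|lborel. r z) =
        ennreal (LINT z:{- real n..real n}|lborel. e z)"
    proof eventually_elim
      case (elim n)
      have "0 \<le> (LINT z:{- real n..real n}|lborel. r z)"
        unfolding set_lebesgue_integral_def using r_nonneg by (intro integral_nonneg_AE) simp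
      then show ?case using elim unfolding ec by (simp add: ennreal_plus)
    qed
    have "(\<lambda>n. ennreal (c n) + ennreal (LINT z:{- real n..real n}|lborel. r z)) \<longlonglongrightarrow>
        ennreal C + (\<integral>\<^sup>+z. ennreal (r z) \<partial>lborel)"
      by (intro tendsto_add tendsto_ennrealI c nn_integral_tendsto_expanding rm r_nonneg ri)
    then have "(\<lambda>n. ennreal (LINT z:{- real n..real n}|lborel. e z)) \<longlonglongrightarrow>
        ennreal C + (\<integral>\<^sup>+z. ennreal (r z) \<partial>lborel)"
      using tendsto_cong[OF ev] by blast
    moreover have "(\<lambda>n. ennreal (LINT z:{- real n..real n}|lborel. e z)) \<longlonglongrightarrow> (\<integral>\<^sup>+z. ennreal (e z) \<partial>lborel)"
      by (intro nn_integral_tendsto_expanding em e_nonneg ei)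
    ultimately have "(\<integral>\<^sup>+z. ennreal (e z) \<partial>lborel) = ennreal C + (\<integral>\<^sup>+z. ennreal (r z) \<partial>lborel)"
      using LIMSEQ_unique by blast
    moreover have "energy lam Lam (U, V) = (\<integral>\<^sup>+z. ennreal (e z) \<partial>lborel)"
      by (simp add: energy_def e_def potential_def g_def h_def add.assoc)
    ultimately show ?thesis using rm by (simp add: r_def)
  qed
  ultimately show ?thesis using that by blast
qed

lemma minimizer_profile: "minimizer lam Lam (u, v)"
  and minimizer_translate:
    "minimizer lam Lam (U, V) \<Longrightarrow> \<exists>s. \<forall>z. U z = u (z + s) \<and> V z = v (z + s)"
proof -
  obtain C where C: "C > 0" "\<And>U V. (U, V) \<in> admissible \<Longrightarrow>
      excess U V \<in> borel_measurable lborel \<and>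
      energy lam Lam (U, V) = ennreal C + (\<integral>\<^sup>+z. ennreal (excess U V z) \<partial>lborel)"
    using energy_eq_excess by blast
  have wu: "u \<in> W12_loc" "AE z in lborel. weak_deriv u z = u' z"
    by (rule weak_deriv_C1[OF u cont_uv(3)])+
  have wv: "v \<in> W12_loc" "AE z in lborel. weak_deriv v z = v' z"
    by (rule weak_deriv_C1[OF v cont_uv(4)])+
  have adm: "(u, v) \<in> admissible" using wu wv connecting by (simp add: admissible_def)
  have "AE z in lborel. excess u v z = 0"
    using wu(2) wv(2)
    by eventually_elim (simp add: excess_def gap_diagonal u.phase_speed_profile v.phase_speed_profile)
  then have "AE z in lborel. ennreal (excess u v z) = 0" by eventually_elim simp
  then have "(\<integral>\<^sup>+z. ennreal (excess u v z) \<partial>lborel) = (\<integral>\<^sup>+z. 0 \<partial>(lborel :: real measure))"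
    by (rule nn_integral_cong_AE)
  then have E: "energy lam Lam (u, v) = ennreal C" using C(2)[OF adm] by simp
  show min: "minimizer lam Lam (u, v)"
    unfolding minimizer_def
  proof (intro conjI adm ballI)
    fix w assume w: "w \<in> admissible"
    obtain U V where "w = (U, V)" by (cases w)
    then have "energy lam Lam w = ennreal C + (\<integral>\<^sup>+z. ennreal (excess U V z) \<partial>lborel)"
      using C(2)[of U V] w by simp
    then show "energy lam Lam (u, v) \<le> energy lam Lam w" using E by simp
  qed
  assume UV: "minimizer lam Lam (U, V)"
  then have a: "(U, V) \<in> admissible" by (simp add: minimizer_def)
  have em: "excess U V \<in> borel_measurable lborel" using C(2)[OF a] by blast
  have "energy lam Lam (U, V) \<le> energy lam Lam (u, v)" using UV adm unfolding minimizer_def by blast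
  then have "ennreal C + (\<integral>\<^sup>+z. ennreal (excess U V z) \<partial>lborel) \<le> ennreal C + 0"
    using C(2)[OF a] E by simp
  \<comment> \<open>Cancellation is legitimate in \<open>ennreal\<close> because
    \<open>ennreal C\<close> is finite.\<close>
  then have "(\<integral>\<^sup>+z. ennreal (excess U V z) \<partial>lborel) = 0"
    by (subst (asm) ennreal_add_left_cancel_le) auto
  then have "AE z in lborel. ennreal (excess U V z) = 0"
    using em by (subst (asm) nn_integral_0_iff_AE) auto
  then have z: "AE z in lborel. excess U V z = 0"
  proof eventually_elim
    case (elim z)
    then show ?case using excess_nonneg[of U V z] by (simp add: ennreal_eq_0_iff)
  qed
  have parts: "weak_deriv U z = p (U z) \<and> weak_deriv V z = q (V z) \<and> gap (U z) (V z) = 0"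
    if "excess U V z = 0" for z
  proof -
    have "0 \<le> lam\<^sup>2 * (weak_deriv U z - p (U z))\<^sup>2 / 2" "0 \<le> (weak_deriv V z - q (V z))\<^sup>2 / 2"
      by simp_all
    then have "lam\<^sup>2 * (weak_deriv U z - p (U z))\<^sup>2 / 2 = 0" "(weak_deriv V z - q (V z))\<^sup>2 / 2 = 0"
      "gap (U z) (V z) = 0"
      using that gap_nonneg[of "U z" "V z"] unfolding excess_def by linarith+
    then show ?thesis using lam by simp
  qed
  have con: "connecting U V" and WU: "U \<in> W12_loc" and WV: "V \<in> W12_loc"
    using a by (auto simp: admissible_def)
  have cU: "continuous_on UNIV U" and cV: "continuous_on UNIV V" using WU WV by (auto simp: W12_loc_def)
  \<comment> \<open>The translation result needs one point with value strictly between 0 and 1; the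
    value 1/2 is always attained. Writing the limits as x and 1 - x treats \<open>U\<close> and
    \<open>V\<close> together.\<close>
  have mid: "\<exists>z. 0 < F z \<and> F z < 1"
    if F: "continuous_on UNIV F" "(F \<longlongrightarrow> x) at_bot" "(F \<longlongrightarrow> 1 - x) at_top" "x = 0 \<or> x = 1" for F :: "real \<Rightarrow> real" and x
  proof -
    have "\<forall>\<^sub>F z in at_bot. dist (F z) x < 1 / 2" "\<forall>\<^sub>F z in at_top. dist (F z) (1 - x) < 1 / 2"
      using F(2,3)[THEN tendstoD, of "1 / 2"] by simp_all
    then obtain s t where st: "\<And>z. z \<le> s \<Longrightarrow> dist (F z) x < 1 / 2" "\<And>z. z \<ge> t \<Longrightarrow> dist (F z) (1 - x) < 1 / 2"
      unfolding eventually_at_bot_linorder eventually_at_top_linorder by blast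
    define l m where "l = min s t" and "m = max s t"
    have lm: "l \<le> m" "dist (F l) x < 1 / 2" "dist (F m) (1 - x) < 1 / 2"
      using st by (simp_all add: l_def m_def)
    have cF: "continuous_on {l..m} F" using F(1) by (rule continuous_on_subset) simp
    have half: "\<exists>z. F z = 1 / 2"
      using F(4)
    proof
      assume "x = 0"
      then have "F l \<le> 1 / 2" "1 / 2 \<le> F m" using lm unfolding dist_real_def by linarith+
      then show ?thesis using IVT'[OF _ _ lm(1) cF] by blast
    next
      assume "x = 1"
      then have "F m \<le> 1 / 2" "1 / 2 \<le> F l" using lm unfolding dist_real_def by linarith+
      then show ?thesis using IVT2'[OF _ _ lm(1) cF] by blast
    qed
    from half obtain z where "F z = 1 / 2" ..
    then show ?thesis by (intro exI[of _ z]) simp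
  qed
  obtain z1 where z1: "0 < U z1" "U z1 < 1" using mid[OF cU, of 0] con by (auto simp: connecting_def)
  obtain z2 where z2: "0 < V z2" "V z2 < 1" using mid[OF cV, of 1] con by (auto simp: connecting_def)
  have "AE z in lborel. weak_deriv U z = p (U z)" using z by eventually_elim (simp add: parts)
  then obtain s where s: "\<And>z. U z = u (z + s)"
    using u.weak_phase_ode_translate[OF cU W12_loc_weak_deriv(1)[OF WU] _ z1] by blast
  have "AE z in lborel. weak_deriv V z = q (V z)" using z by eventually_elim (simp add: parts)
  then obtain t where t: "\<And>z. V z = v (z + t)"
    using v.weak_phase_ode_translate[OF cV W12_loc_weak_deriv(1)[OF WV] _ z2] by blast
  \<comment> \<open>One zero of the gap is enough to match the phases: \<open>U\<close> and
    \<open>V\<close> are already known to be translates, and the gap is positive off the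
    diagonal.\<close>
  obtain z0 where "gap (U z0) (V z0) = 0" using AE_lborel_ex[OF z] parts by blast
  then have "s = t" using gap_off_diagonal[of "z0 + s" "z0 + t"] by (auto simp: s t)
  then show "\<exists>s. \<forall>z. U z = u (z + s) \<and> V z = v (z + s)" using s t by blast
qed

end

section \<open>Monotonicity of the heteroclinic orbit\<close>

text \<open>Here r = 1 - e^2 w_1 and phi_1 are polar coordinates of (u, v), with \<open>S\<close>,
  \<open>K\<close> its sine and cosine, L = 1/lambda^2, b = w_2 and d = phi_2. \<open>B\<close> and
  \<open>D\<close> are e w_2' and phi_2', and the left-hand sides are the second derivatives of u
  and v in z.\<close>

lemma polar_accelerations:
  fixes r e S K L B D X b d :: real
  assumes "r \<noteq> 0" and SK: "S\<^sup>2 + K\<^sup>2 = 1" and X: "e\<^sup>2 * X = r\<^sup>2 - 1"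
    and B: "B = - r * d\<^sup>2 - r * X * (1 + (L - 1) * K\<^sup>2) - r ^ 3 * (L + 1) * S\<^sup>2 * K\<^sup>2"
    and D: "D = 2 * e * b * d / r + (1 - L) * X * S * K + r\<^sup>2 * (S * K ^ 3 - L * K * S ^ 3)"
  shows "- e\<^sup>2 * B * K + 2 * e ^ 3 * b * S * d - e\<^sup>2 * r * K * d\<^sup>2 - e\<^sup>2 * r * S * D =
      L * ((r * K) ^ 3 - r * K + (1 + e\<^sup>2) * (r * S)\<^sup>2 * (r * K))"
    and "- e\<^sup>2 * B * S - 2 * e ^ 3 * b * K * d - e\<^sup>2 * r * S * d\<^sup>2 + e\<^sup>2 * r * K * D =
      (r * S) ^ 3 - r * S + (1 + e\<^sup>2) * (r * K)\<^sup>2 * (r * S)"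
proof -
  \<comment> \<open>Clearing the denominator leaves polynomial relations only, from which
    \<open>algebra\<close> derives both identities.\<close>
  have rD: "r * D = 2 * e * b * d + r * ((1 - L) * X * S * K + r\<^sup>2 * (S * K ^ 3 - L * K * S ^ 3))"
    using \<open>r \<noteq> 0\<close> unfolding D by (simp add: field_simps)
  show "- e\<^sup>2 * B * K + 2 * e ^ 3 * b * S * d - e\<^sup>2 * r * K * d\<^sup>2 - e\<^sup>2 * r * S * D =
      L * ((r * K) ^ 3 - r * K + (1 + e\<^sup>2) * (r * S)\<^sup>2 * (r * K))"
    using SK X B rD by algebra
  show "- e\<^sup>2 * B * S - 2 * e ^ 3 * b * K * d - e\<^sup>2 * r * S * d\<^sup>2 + e\<^sup>2 * r * K * D =
      (r * S) ^ 3 - r * S + (1 + e\<^sup>2) * (r * K)\<^sup>2 * (r * S)"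
    using SK X B rD by algebra
qed

lemma filterlim_scale_real:
  fixes c :: real
  assumes "c > 0"
  shows "filterlim (\<lambda>x. c * x) at_top at_top" "filterlim (\<lambda>x. c * x) at_bot at_bot"
  by (rule filterlim_tendsto_pos_mult_at_top[OF tendsto_const assms filterlim_ident]
      filterlim_tendsto_pos_mult_at_bot[OF tendsto_const assms filterlim_ident])+

text \<open>The hypotheses \<open>pos\<close> and \<open>neg\<close> are u' > 0 and v' < 0 in the
  slow variables: the expressions there arise from u' and v' by taking out the factors -eps and
  eps.\<close>

lemma orbit_monotone_connection:
  fixes lam eps :: real
  assumes lam: "lam > 0" and eps: "eps > 0"
    and S: "solves_S lam eps w1 w2 p1 p2 UNIV"
    and bot: "((\<lambda>x. (w1 x, w2 x, p1 x, p2 x)) \<longlongrightarrow> (0, 0, pi / 2, 0)) at_bot"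
    and top: "((\<lambda>x. (w1 x, w2 x, p1 x, p2 x)) \<longlongrightarrow> (0, 0, 0, 0)) at_top"
    and pos: "\<And>x. eps * w2 x * cos (p1 x) + (1 - eps\<^sup>2 * w1 x) * sin (p1 x) * p2 x < 0"
    and neg: "\<And>x. (1 - eps\<^sup>2 * w1 x) * cos (p1 x) * p2 x < eps * w2 x * sin (p1 x)"
  defines "u \<equiv> \<lambda>z. (1 - eps\<^sup>2 * w1 (eps * z)) * cos (p1 (eps * z))"
    and "v \<equiv> \<lambda>z. (1 - eps\<^sup>2 * w1 (eps * z)) * sin (p1 (eps * z))"
    and "u' \<equiv> \<lambda>z. - eps\<^sup>2 * w2 (eps * z) * cos (p1 (eps * z))
        - eps * (1 - eps\<^sup>2 * w1 (eps * z)) * sin (p1 (eps * z)) * p2 (eps * z)"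
    and "v' \<equiv> \<lambda>z. - eps\<^sup>2 * w2 (eps * z) * sin (p1 (eps * z))
        + eps * (1 - eps\<^sup>2 * w1 (eps * z)) * cos (p1 (eps * z)) * p2 (eps * z)"
  shows "monotone_connection lam (1 + eps\<^sup>2) u v u' v'"
proof
  define X where "X x = eps\<^sup>2 * (w1 x)\<^sup>2 - 2 * w1 x" for x
  define B where "B x = - (1 - eps\<^sup>2 * w1 x) * (p2 x)\<^sup>2 - (1 - eps\<^sup>2 * w1 x) * X x * (1 + (1 / lam\<^sup>2 - 1) * (cos (p1 x))\<^sup>2)
         - (1 - eps\<^sup>2 * w1 x) ^ 3 * (1 / lam\<^sup>2 + 1) * (sin (p1 x))\<^sup>2 * (cos (p1 x))\<^sup>2" for x
  define D where "D x = 2 * eps * w2 x * p2 x / (1 - eps\<^sup>2 * w1 x) + (1 - 1 / lam\<^sup>2) * X x * sin (p1 x) * cos (p1 x)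
         + (1 - eps\<^sup>2 * w1 x)\<^sup>2 * (sin (p1 x) * cos (p1 x) ^ 3 - 1 / lam\<^sup>2 * cos (p1 x) * sin (p1 x) ^ 3)" for x
  have S': "1 - eps\<^sup>2 * w1 x \<noteq> 0" "(w1 has_real_derivative w2 x / eps) (at x)"
    "(w2 has_real_derivative B x / eps) (at x)" "(p1 has_real_derivative p2 x) (at x)"
    "(p2 has_real_derivative D x) (at x)" for x
    using S unfolding solves_S_def B_def D_def X_def by blast+
  have scale: "((\<lambda>z. eps * z) has_real_derivative eps) (at z)" for z
    by (auto intro!: derivative_eq_intros)
  define a b c d where "a z = w1 (eps * z)" and "b z = w2 (eps * z)" and "c z = p1 (eps * z)"
    and "d z = p2 (eps * z)" for z
  note abcd = a_def b_def c_def d_def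
  have d1: "(a has_real_derivative b z) (at z)" and d2: "(b has_real_derivative B (eps * z)) (at z)"
    and d3: "(c has_real_derivative eps * d z) (at z)" and d4: "(d has_real_derivative eps * D (eps * z)) (at z)" for z
    using DERIV_chain2[OF S'(2) scale, of z] DERIV_chain2[OF S'(3) scale, of z]
      DERIV_chain2[OF S'(4) scale, of z] DERIV_chain2[OF S'(5) scale, of z] eps
    by (simp_all add: abcd[abs_def] mult.commute)
  have u_eq: "u = (\<lambda>z. (1 - eps\<^sup>2 * a z) * cos (c z))"
    and v_eq: "v = (\<lambda>z. (1 - eps\<^sup>2 * a z) * sin (c z))"
    and u'_eq: "u' = (\<lambda>z. - eps\<^sup>2 * b z * cos (c z) - eps * (1 - eps\<^sup>2 * a z) * sin (c z) * d z)"
    and v'_eq: "v' = (\<lambda>z. - eps\<^sup>2 * b z * sin (c z) + eps * (1 - eps\<^sup>2 * a z) * cos (c z) * d z)"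
    by (simp_all add: u_def v_def u'_def v'_def abcd)
  have X: "eps\<^sup>2 * X x = (1 - eps\<^sup>2 * w1 x)\<^sup>2 - 1" for x
    by (simp add: X_def power2_eq_square algebra_simps)
  note acc = polar_accelerations[OF S'(1) sin_cos_squared_add X B_def D_def, of "eps * z" for z, folded abcd]
  show "lam > 0" "1 + eps\<^sup>2 \<ge> 1" using lam by auto
  show "(u has_real_derivative u' z) (at z)" for z
    unfolding u_eq u'_eq
    by (rule derivative_eq_intros d1 d3 refl)+ (simp add: algebra_simps power2_eq_square)
  show "(v has_real_derivative v' z) (at z)" for z
    unfolding v_eq v'_eq
    by (rule derivative_eq_intros d1 d3 refl)+ (simp add: algebra_simps power2_eq_square)
  show "(u' has_real_derivative (u z ^ 3 - u z + (1 + eps\<^sup>2) * (v z)\<^sup>2 * u z) / lam\<^sup>2) (at z)" for z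
  proof -
    let ?r = "1 - eps\<^sup>2 * a z"
    have "(u' has_real_derivative - eps\<^sup>2 * B (eps * z) * cos (c z) + 2 * eps ^ 3 * b z * sin (c z) * d z
        - eps\<^sup>2 * ?r * cos (c z) * (d z)\<^sup>2 - eps\<^sup>2 * ?r * sin (c z) * D (eps * z)) (at z)"
      unfolding u'_eq
      by (rule derivative_eq_intros d1 d2 d3 d4 refl)+ (simp add: algebra_simps power2_eq_square power3_eq_cube)
    then show ?thesis unfolding acc(1) by (simp add: u_eq v_eq)
  qed
  show "(v' has_real_derivative v z ^ 3 - v z + (1 + eps\<^sup>2) * (u z)\<^sup>2 * v z) (at z)" for z
  proof -
    let ?r = "1 - eps\<^sup>2 * a z"
    have "(v' has_real_derivative - eps\<^sup>2 * B (eps * z) * sin (c z) - 2 * eps ^ 3 * b z * cos (c z) * d z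
        - eps\<^sup>2 * ?r * sin (c z) * (d z)\<^sup>2 + eps\<^sup>2 * ?r * cos (c z) * D (eps * z)) (at z)"
      unfolding v'_eq
      by (rule derivative_eq_intros d1 d2 d3 d4 refl)+ (simp add: algebra_simps power2_eq_square power3_eq_cube)
    then show ?thesis unfolding acc(2) by (simp add: u_eq v_eq)
  qed
  show "u' z > 0" for z
  proof -
    have "u' z = - eps * (eps * w2 (eps * z) * cos (p1 (eps * z))
        + (1 - eps\<^sup>2 * w1 (eps * z)) * sin (p1 (eps * z)) * p2 (eps * z))"
      by (simp add: u'_def algebra_simps power2_eq_square power3_eq_cube)
    also have "\<dots> > 0" using eps by (intro mult_neg_neg pos) simp
    finally show ?thesis .
  qed
  show "v' z < 0" for z
  proof -
    have "v' z = eps * ((1 - eps\<^sup>2 * w1 (eps * z)) * cos (p1 (eps * z)) * p2 (eps * z)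
        - eps * w2 (eps * z) * sin (p1 (eps * z)))"
      by (simp add: v'_def algebra_simps power2_eq_square power3_eq_cube)
    also have "\<dots> < 0" using eps neg[of "eps * z"] by (intro mult_pos_neg) simp_all
    finally show ?thesis .
  qed
  note b = filterlim_compose[OF _ filterlim_scale_real(2)[OF eps]]
  note t = filterlim_compose[OF _ filterlim_scale_real(1)[OF eps]]
  have lb: "(w1 \<longlongrightarrow> 0) at_bot" "(w2 \<longlongrightarrow> 0) at_bot" "(p1 \<longlongrightarrow> pi / 2) at_bot" "(p2 \<longlongrightarrow> 0) at_bot"
    using tendsto_fst[OF bot] tendsto_fst[OF tendsto_snd[OF bot]]
      tendsto_fst[OF tendsto_snd[OF tendsto_snd[OF bot]]] tendsto_snd[OF tendsto_snd[OF tendsto_snd[OF bot]]]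
    by simp_all
  have lt: "(w1 \<longlongrightarrow> 0) at_top" "(w2 \<longlongrightarrow> 0) at_top" "(p1 \<longlongrightarrow> 0) at_top" "(p2 \<longlongrightarrow> 0) at_top"
    using tendsto_fst[OF top] tendsto_fst[OF tendsto_snd[OF top]]
      tendsto_fst[OF tendsto_snd[OF tendsto_snd[OF top]]] tendsto_snd[OF tendsto_snd[OF tendsto_snd[OF top]]]
    by simp_all
  note lims = lb[THEN b] lt[THEN t]
  have "(u \<longlongrightarrow> (1 - eps\<^sup>2 * 0) * cos (pi / 2)) at_bot" "(v \<longlongrightarrow> (1 - eps\<^sup>2 * 0) * sin (pi / 2)) at_bot"
    "(u \<longlongrightarrow> (1 - eps\<^sup>2 * 0) * cos 0) at_top" "(v \<longlongrightarrow> (1 - eps\<^sup>2 * 0) * sin 0) at_top"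
    unfolding u_def v_def by (intro tendsto_intros lims)+
  then show "connecting u v" by (simp add: connecting_def)
  have "(u' \<longlongrightarrow> - eps\<^sup>2 * 0 * cos (pi / 2) - eps * (1 - eps\<^sup>2 * 0) * sin (pi / 2) * 0) at_bot"
    "(u' \<longlongrightarrow> - eps\<^sup>2 * 0 * cos 0 - eps * (1 - eps\<^sup>2 * 0) * sin 0 * 0) at_top"
    "(v' \<longlongrightarrow> - eps\<^sup>2 * 0 * sin (pi / 2) + eps * (1 - eps\<^sup>2 * 0) * cos (pi / 2) * 0) at_bot"
    "(v' \<longlongrightarrow> - eps\<^sup>2 * 0 * sin 0 + eps * (1 - eps\<^sup>2 * 0) * cos 0 * 0) at_top"
    unfolding u'_def v'_def by (intro tendsto_intros lims)+
  then show "(u' \<longlongrightarrow> 0) at_bot" "(u' \<longlongrightarrow> 0) at_top" "(v' \<longlongrightarrow> 0) at_bot" "(v' \<longlongrightarrow> 0) at_top" by simp_all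
qed

section \<open>Quantitative bounds that decide the signs of the derivatives of u and v\<close>

text \<open>The denominator \<open>D\<close> satisfies 1/lam <= D <= 1 and sin f <= D. Hence exp(x)
  sin f is nondecreasing for x >= 0 and exp(-x/lam) cos f is nonincreasing for x <= 0, which gives
  the decaying factor on each half-line; the other factor is at least sqrt 2 / 2 there. The constant
  7/10 is a rational number below sqrt 2 / 2.\<close>

lemma limit_profile_bounds:
  fixes lam :: real
  assumes lam: "lam \<ge> 1" and f: "limit_profile lam f" and range: "\<And>x. 0 \<le> f x \<and> f x \<le> pi / 2"
  defines "m \<equiv> \<lambda>x. min (exp (x / lam)) (exp (- x))"
  shows "7 / 10 * m x \<le> sin (f x)" "7 / 10 * m x \<le> cos (f x)" "deriv f x \<le> - m x / (2 * lam)"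
    "\<bar>deriv f x\<bar> \<le> 1"
proof -
  define D where "D x = sqrt (1 + (1 / lam\<^sup>2 - 1) * (cos (f x))\<^sup>2)" for x
  define F where "F x = - (sin (f x) * cos (f x) / (lam * D x))" for x
  have fd: "(f has_real_derivative F x) (at x)" for x
  proof -
    have "(f has_real_derivative - 1 / (2 * lam) * sin (2 * f x) / D x) (at x)"
      using f unfolding limit_profile_def D_def by blast
    moreover have "- 1 / (2 * lam) * sin (2 * f x) / D x = F x"
      using lam by (simp add: F_def sin_double)
    ultimately show ?thesis by simp
  qed
  have dF: "deriv f x = F x" for x using fd by (rule DERIV_imp_deriv)
  have s0: "0 \<le> sin (f x)" and c0: "0 \<le> cos (f x)" for x
    using range[of x] by (auto intro!: sin_ge_zero cos_ge_zero)
  have sc: "(sin (f x))\<^sup>2 = 1 - (cos (f x))\<^sup>2" for x by (simp add: sin_squared_eq)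
  have c1: "(cos (f x))\<^sup>2 \<le> 1" for x using abs_square_le_1[of "cos (f x)"] by simp
  have L: "0 < 1 / lam\<^sup>2" "1 / lam\<^sup>2 \<le> 1" using lam by (auto simp: one_le_power)
  \<comment> \<open>The difference of the squares is (cos f)^2 / lam^2.\<close>
  have D_sin: "sin (f x) \<le> D x" for x
  proof -
    have "(sin (f x))\<^sup>2 \<le> 1 + (1 / lam\<^sup>2 - 1) * (cos (f x))\<^sup>2"
    proof -
      have "0 \<le> 1 / lam\<^sup>2 * (cos (f x))\<^sup>2" using L(1) by (intro mult_nonneg_nonneg) auto
      then show ?thesis unfolding sc left_diff_distrib by simp
    qed
    then show ?thesis unfolding D_def by (rule real_le_rsqrt)
  qed
  have D_le: "D x \<le> 1" for x
  proof -
    have "(1 / lam\<^sup>2 - 1) * (cos (f x))\<^sup>2 \<le> 0" using L(2) by (intro mult_nonpos_nonneg) auto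
    then show ?thesis by (simp add: D_def)
  qed
  have D_ge: "1 \<le> lam * D x" for x
  proof -
    have "(1 - 1 / lam\<^sup>2) * (cos (f x))\<^sup>2 \<le> (1 - 1 / lam\<^sup>2) * 1" using L(2) c1 by (intro mult_left_mono) auto
    then have "(1 / lam)\<^sup>2 \<le> 1 + (1 / lam\<^sup>2 - 1) * (cos (f x))\<^sup>2"
      by (simp add: power_divide algebra_simps)
    then have "1 / lam \<le> D x" unfolding D_def by (rule real_le_rsqrt)
    then show ?thesis using lam by (simp add: divide_le_eq mult.commute)
  qed
  have D_pos: "0 < D x" for x using D_ge[of x] lam by (intro zero_less_mult_pos[of lam "D x"]) auto
  have F_neg: "F x \<le> 0" for x
    using s0[of x] c0[of x] D_pos[of x] lam by (simp add: F_def)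
  have F_lower: "- F x \<le> sin (f x) * cos (f x)" for x
    using s0[of x] c0[of x] D_ge[of x] divide_left_mono[of 1 "lam * D x" "sin (f x) * cos (f x)"]
    by (simp add: F_def)
  have F_upper: "F x \<le> - (sin (f x) * cos (f x) / lam)" for x
    using s0[of x] c0[of x] D_pos[of x] D_le[of x] lam
      divide_left_mono[of "lam * D x" lam "sin (f x) * cos (f x)"]
    by (simp add: F_def mult_left_le)
  \<comment> \<open>The common value of sine and cosine at f 0 = pi/4. Since k^2 = 1/2, the product
    sin f * cos f is at least m/2.\<close>
  define k :: real where "k = sqrt 2 / 2"
  have "7 / 5 \<le> sqrt 2" by (rule real_le_rsqrt) (simp add: power2_eq_square)
  then have k: "7 / 10 \<le> k" "0 < k" by (simp_all add: k_def)
  have k2: "k * k = 1 / 2" by (simp add: k_def)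
  have f0: "f 0 = pi / 4" using f by (simp add: limit_profile_def)
  have anti: "f y \<le> f x" if "x \<le> y" for x y
    by (rule DERIV_nonpos_imp_nonincreasing[OF that]) (use fd F_neg in blast)
  have sin_left: "k \<le> sin (f x)" if "x \<le> 0" for x
  proof -
    have "sin (pi / 4) \<le> sin (f x)" using anti[OF that] range[of x] f0 by (intro sin_monotone_2pi_le) auto
    then show ?thesis by (simp add: k_def sin_45)
  qed
  have cos_right: "k \<le> cos (f x)" if "0 \<le> x" for x
  proof -
    have "cos (pi / 4) \<le> cos (f x)" using anti[OF that] range[of x] f0 by (intro cos_monotone_0_pi_le) auto
    then show ?thesis by (simp add: k_def cos_45)
  qed
  have sin_right: "k * exp (- x) \<le> sin (f x)" if "0 \<le> x" for x
  proof -
    have "exp 0 * sin (f 0) \<le> exp x * sin (f x)"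
    proof (rule DERIV_nonneg_imp_nondecreasing[OF that])
      fix y
      have "- F y * cos (f y) \<le> sin (f y) * cos (f y) * cos (f y)"
        by (rule mult_right_mono[OF F_lower c0])
      also have "\<dots> = sin (f y) * (cos (f y))\<^sup>2" by (simp add: power2_eq_square)
      also have "\<dots> \<le> sin (f y) * 1" by (rule mult_left_mono[OF c1 s0])
      finally have "0 \<le> exp y * (sin (f y) + cos (f y) * F y)"
        by (intro mult_nonneg_nonneg) (auto simp: mult.commute)
      moreover have "((\<lambda>y. exp y * sin (f y)) has_real_derivative exp y * (sin (f y) + cos (f y) * F y)) (at y)"
        by (auto intro!: derivative_eq_intros fd simp: algebra_simps)
      ultimately show "\<exists>d. ((\<lambda>y. exp y * sin (f y)) has_real_derivative d) (at y) \<and> 0 \<le> d" by blast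
    qed
    then have "k \<le> exp x * sin (f x)" by (simp add: f0 k_def sin_45)
    then have "exp (- x) * k \<le> exp (- x) * (exp x * sin (f x))" by (rule mult_left_mono) simp
    then show ?thesis by (simp add: mult.assoc[symmetric] mult.commute flip: exp_add)
  qed
  have cos_left: "k * exp (x / lam) \<le> cos (f x)" if "x \<le> 0" for x
  proof -
    define l where "l = 1 / lam"
    have l: "0 < l" using lam by (simp add: l_def)
    have "exp (- (l * 0)) * cos (f 0) \<le> exp (- (l * x)) * cos (f x)"
    proof (rule DERIV_nonpos_imp_nonincreasing[OF that])
      fix y
      have "sin (f y) * sin (f y) \<le> 1 * D y"
        using s0[of y] D_sin[of y] by (intro mult_mono) auto
      then have "sin (f y) * sin (f y) / D y - 1 \<le> 0" using D_pos[of y] by (simp add: divide_le_eq)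
      then have "l * cos (f y) * (sin (f y) * sin (f y) / D y - 1) \<le> 0"
        using c0[of y] l by (intro mult_nonneg_nonpos) auto
      moreover have "l * cos (f y) * (sin (f y) * sin (f y) / D y - 1) = - sin (f y) * F y - l * cos (f y)"
        using D_pos[of y] lam by (simp add: F_def l_def field_simps)
      ultimately have "exp (- (l * y)) * (- sin (f y) * F y - l * cos (f y)) \<le> 0"
        by (intro mult_nonneg_nonpos) auto
      moreover have "((\<lambda>y. exp (- (l * y)) * cos (f y)) has_real_derivative
          exp (- (l * y)) * (- sin (f y) * F y - l * cos (f y))) (at y)"
        by (auto intro!: derivative_eq_intros fd) (simp add: algebra_simps)
      ultimately show "\<exists>d. ((\<lambda>y. exp (- (l * y)) * cos (f y)) has_real_derivative d) (at y) \<and> d \<le> 0" by blast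
    qed
    then have "k \<le> exp (- (l * x)) * cos (f x)" by (simp add: f0 k_def cos_45)
    then have "exp (l * x) * k \<le> exp (l * x) * (exp (- (l * x)) * cos (f x))" by (rule mult_left_mono) simp
    also have "\<dots> = cos (f x)" by (simp add: mult.assoc[symmetric] flip: exp_add)
    finally show ?thesis by (simp add: l_def mult.commute)
  qed
  have m_le: "m x \<le> 1" "0 < m x" for x
    using lam by (cases "0 \<le> x") (auto simp: m_def min_le_iff_disj divide_le_0_iff)
  have *: "k * m x \<le> sin (f x) \<and> k * m x \<le> cos (f x) \<and> m x / 2 \<le> sin (f x) * cos (f x)" for x
  proof (cases "0 \<le> x")
    case True
    have 1: "k * m x \<le> k * exp (- x)" "k * m x \<le> k * 1"
      by (intro mult_left_mono; use k m_le[of x] in \<open>simp add: m_def\<close>)+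
    have "k * m x * k \<le> sin (f x) * cos (f x)"
    proof (rule mult_mono)
      show "k * m x \<le> sin (f x)" using sin_right[OF True] 1 by linarith
    qed (use cos_right[OF True] k s0 in simp_all)
    moreover have "k * m x * k = m x / 2" using k2 by simp
    ultimately show ?thesis using sin_right[OF True] cos_right[OF True] 1 by linarith
  next
    case False
    then have x: "x \<le> 0" by simp
    have 1: "k * m x \<le> k * exp (x / lam)" "k * m x \<le> k * 1"
      by (intro mult_left_mono; use k m_le[of x] in \<open>simp add: m_def\<close>)+
    have "k * (k * m x) \<le> sin (f x) * cos (f x)"
    proof (rule mult_mono)
      show "k * m x \<le> cos (f x)" using cos_left[OF x] 1 by linarith
    qed (use sin_left[OF x] k s0 m_le[of x] in simp_all)
    moreover have "k * (k * m x) = m x / 2" using k2 by simp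
    ultimately show ?thesis using sin_left[OF x] cos_left[OF x] 1 by linarith
  qed
  have "7 / 10 * m x \<le> k * m x" using k m_le[of x] by (intro mult_right_mono) auto
  then show "7 / 10 * m x \<le> sin (f x)" "7 / 10 * m x \<le> cos (f x)" using *[of x] by linarith+
  have "m x / 2 / lam \<le> sin (f x) * cos (f x) / lam" using *[of x] lam by (intro divide_right_mono) auto
  then show "deriv f x \<le> - m x / (2 * lam)" using F_upper[of x] unfolding dF by simp
  have "sin (f x) * cos (f x) \<le> 1 * 1" using s0[of x] c0[of x] by (intro mult_mono) auto
  then show "\<bar>deriv f x\<bar> \<le> 1" using F_neg[of x] F_lower[of x] unfolding dF by simp
qed


lemma abs_sin_diff_le: "\<bar>sin x - sin y\<bar> \<le> \<bar>x - y\<bar>" for x y :: real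
proof -
  have "\<bar>sin x - sin y\<bar> = 2 * (\<bar>sin ((x - y) / 2)\<bar> * \<bar>cos ((x + y) / 2)\<bar>)"
    by (simp add: sin_diff_sin abs_mult)
  also have "\<dots> \<le> 2 * (\<bar>(x - y) / 2\<bar> * 1)"
    by (intro mult_left_mono mult_mono abs_sin_x_le_abs_x abs_cos_le_one) auto
  finally show ?thesis by simp
qed

lemma abs_cos_diff_le: "\<bar>cos x - cos y\<bar> \<le> \<bar>x - y\<bar>" for x y :: real
  using abs_sin_diff_le[of "pi / 2 - x" "pi / 2 - y"] by (simp add: sin_diff abs_minus_commute)

text \<open>The numerator is at most 4 + 2 and the denominator at least 2/lam^2. The bound keeps 1 -
  eps^2 w_1 away from zero.\<close>

lemma critical_w1_le:
  assumes lam: "lam \<ge> 1" and b: "\<bar>b\<bar> \<le> 2"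
  shows "critical_w1 lam a b \<le> 3 * lam\<^sup>2"
proof -
  have L: "0 < 1 / lam\<^sup>2" "1 / lam\<^sup>2 \<le> 1" using lam by (auto simp: one_le_power)
  have c: "(cos a)\<^sup>2 \<le> 1" and s: "(sin a)\<^sup>2 \<le> 1"
    using abs_square_le_1[of "cos a"] abs_square_le_1[of "sin a"] by simp_all
  have "(1 - 1 / lam\<^sup>2) * (cos a)\<^sup>2 \<le> (1 - 1 / lam\<^sup>2) * 1" using L(2) c by (intro mult_left_mono) auto
  then have D: "1 / lam\<^sup>2 \<le> 1 + (1 / lam\<^sup>2 - 1) * (cos a)\<^sup>2" by (simp add: algebra_simps)
  have "b\<^sup>2 \<le> 2\<^sup>2" using b power_mono[of "\<bar>b\<bar>" 2 2] by simp
  moreover have "(1 / lam\<^sup>2 + 1) * (sin a)\<^sup>2 * (cos a)\<^sup>2 \<le> 2 * 1 * 1"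
    using L c s by (intro mult_mono) auto
  ultimately have N: "b\<^sup>2 + (1 / lam\<^sup>2 + 1) * (sin a)\<^sup>2 * (cos a)\<^sup>2 \<le> 6" by simp
  have "critical_w1 lam a b \<le> 6 / (2 * (1 / lam\<^sup>2))"
    unfolding critical_w1_def using N D L by (intro frac_le) auto
  then show ?thesis by simp
qed

text \<open>The main terms are at most -(1/2)(m/2)(m/(4 lam)) = -m^2/(16 lam). The term with
  \<open>b\<close> is at most \<delta> m^2 <= m^2/(32 lam) in size, half of that, so it cannot
  change the sign however small m is. The bound on \<open>eps\<close> yields the factor 1/2 for 1 -
  eps^2 a.\<close>

lemma orbit_monotone:
  fixes lam eps \<delta> m f' a0 a b c d :: real
  assumes lam: "lam \<ge> 1" and eps: "0 < eps" "eps \<le> 1 / (8 * lam\<^sup>2)" and \<delta>: "0 \<le> \<delta>" "\<delta> \<le> 1 / (32 * lam)"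
    and m: "0 < m" "m \<le> 1"
    and profile: "7 / 10 * m \<le> sin a0" "7 / 10 * m \<le> cos a0" "f' \<le> - m / (2 * lam)" "\<bar>f'\<bar> \<le> 1"
    and a: "\<bar>a - critical_w1 lam c d\<bar> \<le> \<delta> * m\<^sup>2" and b: "\<bar>b\<bar> \<le> \<delta> * m\<^sup>2"
    and c: "\<bar>c - a0\<bar> \<le> \<delta> * m" and d: "\<bar>d - f'\<bar> \<le> \<delta> * m"
  shows "eps * b * cos c + (1 - eps\<^sup>2 * a) * sin c * d < 0"
    and "(1 - eps\<^sup>2 * a) * cos c * d < eps * b * sin c"
proof -
  have "1 / (32 * lam) \<le> 1 / 32" using lam by (intro divide_left_mono) auto
  then have \<delta>1: "\<delta> \<le> 1 / 32" using \<delta> by linarith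
  have lam2: "1 \<le> lam\<^sup>2" using lam by (rule one_le_power)
  then have "1 / (8 * lam\<^sup>2) \<le> 1 / 8" by (intro divide_left_mono) auto
  then have eps1: "eps \<le> 1" using eps by linarith
  have \<delta>m: "\<delta> * m \<le> 1 / 32 * m" "\<delta> * m \<le> 1 / (32 * lam) * m"
    using m(1) by (intro mult_right_mono[OF \<delta>1] mult_right_mono[OF \<delta>(2)]; simp)+
  have sc: "m / 2 \<le> sin c" "m / 2 \<le> cos c"
    using profile(1,2) abs_sin_diff_le[of c a0] abs_cos_diff_le[of c a0] c \<delta>m(1) m(1) by linarith+
  \<comment> \<open>\<open>t\<close> is the lower bound for -f'. The error \<delta> m is at most
    t/16, so \<open>d\<close> keeps at least half of it.\<close>
  define t where "t = m / (2 * lam)"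
  have "\<delta> * m \<le> t / 16" "f' \<le> - t" "0 < t"
    using \<delta>m(2) profile(3) m lam by (simp_all add: t_def)
  then have "d \<le> - (t / 2)" using d by linarith
  then have d_neg: "d \<le> - (m / (4 * lam))" by (simp add: t_def)
  have "\<bar>d\<bar> \<le> 2" using d profile(4) \<delta>m(1) m by linarith
  then have crit: "critical_w1 lam c d \<le> 3 * lam\<^sup>2" by (rule critical_w1_le[OF lam])
  have m2: "0 < m\<^sup>2" "m\<^sup>2 \<le> 1" using m by (auto simp: power_le_one)
  have "\<delta> * m\<^sup>2 \<le> 1 * 1" using \<delta>1 \<delta>(1) m2 by (intro mult_mono) auto
  then have a_le: "a \<le> 4 * lam\<^sup>2" using a crit lam2 by linarith
  have "eps\<^sup>2 * a \<le> eps\<^sup>2 * (4 * lam\<^sup>2)" using a_le by (intro mult_left_mono) auto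
  also have "\<dots> = eps * (eps * (4 * lam\<^sup>2))" by (simp add: power2_eq_square)
  also have "\<dots> \<le> 1 * (1 / (8 * lam\<^sup>2) * (4 * lam\<^sup>2))"
    using eps eps1 by (intro mult_mono mult_right_mono) auto
  also have "\<dots> = 1 / 2" using lam by simp
  finally have r: "1 / 2 \<le> 1 - eps\<^sup>2 * a" by simp
  have key: "(1 - eps\<^sup>2 * a) * s * d \<le> - (m\<^sup>2 / (16 * lam))" if s: "m / 2 \<le> s" for s
  proof -
    have "1 / 2 * (m / 2) * (m / (4 * lam)) \<le> (1 - eps\<^sup>2 * a) * s * (- d)"
      using r s d_neg m lam by (intro mult_mono) auto
    then show ?thesis by (simp add: power2_eq_square)
  qed
  have small: "\<bar>eps * b * t\<bar> < m\<^sup>2 / (16 * lam)" if t: "\<bar>t\<bar> \<le> 1" for t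
  proof -
    have "\<bar>eps * b * t\<bar> = \<bar>eps\<bar> * \<bar>b\<bar> * \<bar>t\<bar>" by (simp add: abs_mult)
    also have "\<dots> \<le> 1 * (\<delta> * m\<^sup>2) * 1"
      using eps eps1 b t \<delta>(1) by (intro mult_mono) auto
    also have "\<dots> \<le> 1 / (32 * lam) * m\<^sup>2" using \<delta>(2) by (simp only: mult_1 mult_1_right) (rule mult_right_mono, auto)
    also have "\<dots> = m\<^sup>2 / (16 * lam) / 2" by simp
    also have "\<dots> < m\<^sup>2 / (16 * lam)"
    proof -
      have "t / 2 < t" if "0 < t" for t :: real using that by simp
      moreover have "0 < m\<^sup>2 / (16 * lam)" using m2 lam by simp
      ultimately show ?thesis by blast
    qed
    finally show ?thesis .
  qed
  show "eps * b * cos c + (1 - eps\<^sup>2 * a) * sin c * d < 0"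
    using key[OF sc(1)] small[OF abs_cos_le_one[of c]] by linarith
  show "(1 - eps\<^sup>2 * a) * cos c * d < eps * b * sin c"
    using key[OF sc(2)] small[OF abs_sin_le_one[of c]] by linarith
qed

section \<open>Application to the heteroclinic family\<close>

theorem mainTheorem3:
  fixes lam eps0 :: real and m :: nat and phi0 :: "real \<Rightarrow> real" and K :: "(real \<times> real) set"
    and h1 h2 :: "(real \<times> real) \<times> real \<Rightarrow> real"
    and w1 w2 p1 p2 :: "real \<Rightarrow> real \<Rightarrow> real"
  assumes "lam \<ge> 1" and "m \<ge> 1"
    and "limit_profile lam phi0"
    and "slow_region phi0 K"
    and "slow_manifold_family lam m K eps0 h1 h2"
    and "heteroclinic_family lam phi0 (\<lambda>eps. slow_graph lam h1 h2 eps K) w1 w2 p1 p2"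
  shows "\<forall>\<^sub>F eps in at_right 0.
    let Lam = 1 + eps\<^sup>2;
        u = (\<lambda>z. (1 - eps\<^sup>2 * w1 eps (eps * z)) * cos (p1 eps (eps * z)));
        v = (\<lambda>z. (1 - eps\<^sup>2 * w1 eps (eps * z)) * sin (p1 eps (eps * z)))
    in heteroclinic_connection lam Lam u v \<and>
       minimizer lam Lam (u, v) \<and>
       (\<forall>U V. minimizer lam Lam (U, V) \<longrightarrow>
          (\<exists>\<tau>. \<forall>z. U z = u (z + \<tau>) \<and> V z = v (z + \<tau>)))"
proof -
  define \<mu> where "\<mu> = (\<lambda>x. min (exp (x / lam)) (exp (- x)))"
  have \<mu>: "0 < \<mu> x" "\<mu> x \<le> 1" for x
    using assms(1) by (cases "0 \<le> x"; simp add: \<mu>_def min_le_iff_disj divide_le_0_iff)+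
  have \<mu>2: "min (exp (2 * x / lam)) (exp (- 2 * x)) = (\<mu> x)\<^sup>2" for x
  proof -
    have "exp (2 * x / lam) = (exp (x / lam))\<^sup>2" "exp (- 2 * x) = (exp (- x))\<^sup>2"
      by (simp_all flip: exp_double)
    then show ?thesis by (simp add: \<mu>_def min_def abs_le_square_iff[symmetric])
  qed
  obtain C where orbit: "\<forall>\<^sub>F eps in at_right 0.
        heteroclinic_orbit lam eps (slow_graph lam h1 h2 eps K) (w1 eps) (w2 eps) (p1 eps) (p2 eps)"
    and C: "\<forall>\<^sub>F eps in at_right 0. \<forall>x.
        \<bar>w1 eps x - critical_w1 lam (p1 eps x) (p2 eps x)\<bar> \<le> C * eps * (\<mu> x)\<^sup>2 \<and>
        \<bar>w2 eps x\<bar> \<le> C * eps * (\<mu> x)\<^sup>2 \<and>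
        \<bar>p1 eps x - phi0 x\<bar> \<le> C * eps * \<mu> x \<and>
        \<bar>p2 eps x - deriv phi0 x\<bar> \<le> C * eps * \<mu> x"
    using assms(6) unfolding heteroclinic_family_def \<mu>2 \<mu>_def[symmetric, THEN fun_cong] by blast
  have small: "((\<lambda>eps. c * eps) \<longlongrightarrow> 0) (at_right 0)" for c :: real
    using tendsto_mult[OF tendsto_const tendsto_ident_at, of c "0 :: real" "{0<..}"] by simp
  \<comment> \<open>\<open>limit_profile\<close> states the equation and the limits at infinity; the
    range is inherited from the orbits, since \<open>phi0 x\<close> is the limit of
    \<open>p1 eps x\<close> as eps tends to 0.\<close>
  have phi0_range: "0 \<le> phi0 x \<and> phi0 x \<le> pi / 2" for x
  proof -
    have "((\<lambda>eps. p1 eps x - phi0 x) \<longlongrightarrow> 0) (at_right 0)"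
    proof (rule Lim_null_comparison)
      show "\<forall>\<^sub>F eps in at_right 0. norm (p1 eps x - phi0 x) \<le> C * \<mu> x * eps"
        using C by eventually_elim (simp add: mult_ac)
    qed (rule small)
    then have lim: "((\<lambda>eps. p1 eps x) \<longlongrightarrow> phi0 x) (at_right 0)" by (rule LIM_zero_cancel)
    have lo: "\<forall>\<^sub>F eps in at_right 0. 0 \<le> p1 eps x" and hi: "\<forall>\<^sub>F eps in at_right 0. p1 eps x \<le> pi / 2"
      using orbit by (eventually_elim, simp add: heteroclinic_orbit_def less_imp_le)+
    show ?thesis using tendsto_lowerbound[OF lim lo] tendsto_upperbound[OF lim hi] by simp
  qed
  have profile: "7 / 10 * \<mu> x \<le> sin (phi0 x)" "7 / 10 * \<mu> x \<le> cos (phi0 x)"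
    "deriv phi0 x \<le> - \<mu> x / (2 * lam)" "\<bar>deriv phi0 x\<bar> \<le> 1" for x
    unfolding \<mu>_def by (rule limit_profile_bounds[OF assms(1,3) phi0_range])+
  have "\<forall>\<^sub>F eps in at_right 0. (0 :: real) < eps" by (simp add: eventually_at_right_less)
  moreover have "\<forall>\<^sub>F eps in at_right 0. 1 * eps < 1 / (8 * lam\<^sup>2)"
    using assms(1) by (intro order_tendstoD(2)[OF small]) simp
  moreover have "\<forall>\<^sub>F eps in at_right 0. \<bar>C\<bar> * eps < 1 / (32 * lam)"
    using assms(1) by (intro order_tendstoD(2)[OF small]) simp
  ultimately show ?thesis using orbit C
  proof eventually_elim
    case (elim eps)
    let ?u = "\<lambda>z. (1 - eps\<^sup>2 * w1 eps (eps * z)) * cos (p1 eps (eps * z))"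
    let ?v = "\<lambda>z. (1 - eps\<^sup>2 * w1 eps (eps * z)) * sin (p1 eps (eps * z))"
    let ?\<delta> = "\<bar>C\<bar> * eps"
    \<comment> \<open>The constant \<open>C\<close> comes without a sign, so |C| replaces it to make
      \<delta> nonnegative.\<close>
    have C_le: "C * eps * y \<le> ?\<delta> * y" if "0 \<le> y" for y
      using elim(1) that by (intro mult_right_mono) auto
    have bounds: "\<bar>w1 eps x - critical_w1 lam (p1 eps x) (p2 eps x)\<bar> \<le> ?\<delta> * (\<mu> x)\<^sup>2"
      "\<bar>w2 eps x\<bar> \<le> ?\<delta> * (\<mu> x)\<^sup>2" "\<bar>p1 eps x - phi0 x\<bar> \<le> ?\<delta> * \<mu> x"
      "\<bar>p2 eps x - deriv phi0 x\<bar> \<le> ?\<delta> * \<mu> x" for x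
      using elim(5)[rule_format, of x] C_le[of "(\<mu> x)\<^sup>2"] C_le[of "\<mu> x"] \<mu>(1)[of x] by auto
    have \<delta>: "0 \<le> ?\<delta>" "?\<delta> \<le> 1 / (32 * lam)" "eps \<le> 1 / (8 * lam\<^sup>2)" using elim(1-3) by simp_all
    note mono = orbit_monotone[OF assms(1) elim(1) \<delta>(3,1,2) \<mu> profile bounds]
    have "monotone_connection lam (1 + eps\<^sup>2) ?u ?v
      (\<lambda>z. - eps\<^sup>2 * w2 eps (eps * z) * cos (p1 eps (eps * z))
        - eps * (1 - eps\<^sup>2 * w1 eps (eps * z)) * sin (p1 eps (eps * z)) * p2 eps (eps * z))
      (\<lambda>z. - eps\<^sup>2 * w2 eps (eps * z) * sin (p1 eps (eps * z))
        + eps * (1 - eps\<^sup>2 * w1 eps (eps * z)) * cos (p1 eps (eps * z)) * p2 eps (eps * z))"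
      using elim(4) assms(1) elim(1) unfolding heteroclinic_orbit_def
      by (intro orbit_monotone_connection mono) auto
    then interpret monotone_connection lam "1 + eps\<^sup>2" ?u ?v
      "\<lambda>z. - eps\<^sup>2 * w2 eps (eps * z) * cos (p1 eps (eps * z))
        - eps * (1 - eps\<^sup>2 * w1 eps (eps * z)) * sin (p1 eps (eps * z)) * p2 eps (eps * z)"
      "\<lambda>z. - eps\<^sup>2 * w2 eps (eps * z) * sin (p1 eps (eps * z))
        + eps * (1 - eps\<^sup>2 * w1 eps (eps * z)) * cos (p1 eps (eps * z)) * p2 eps (eps * z)" .
    have "heteroclinic_connection lam (1 + eps\<^sup>2) ?u ?v"
      by (rule heteroclinic_connection_alt[OF u v u2 v2 _ _ connecting]) (use lam in simp_all)
    then show ?case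
      unfolding Let_def using minimizer_profile minimizer_translate by blast
  qed
qed

end
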